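(* For every finite alphabet $X$ (with a distinguished element $o\in X$), the Mother group $\mathfrak M(X)$ is amenable.
   Context: Let $X$ be a finite set. The homogeneous rooted tree $T=T(X)$ has vertex set $X^*$ (all finite words over $X$, root the empty word), with an edge joining $w$ to $wx$ for all $w\in X^*$, $x\in X$. Let $\mathfrak W(X)=\mathrm{Aut}(T)$ be the group of automorphisms of the rooted tree $T$, with the product $\alpha\beta$ meaning first $\alpha$, then $\beta$. Mother group: fix a distinguished element $o\in X$ and put $\overline X=X\setminus\{o\}$. Let $A=\mathrm{Sym}(X)$ and let $B=A\wr\mathrm{Sym}(\overline X)=A^{\overline X}\rtimes\mathrm{Sym}(\overline X)$ be the permutational wreath product, with multiplication $(\alpha_x)_x\sigma\cdot(\beta_x)_x\tau=(\alpha_x\beta_{\sigma(x)})_x\,\sigma\tau$ (products of permutations read left to right). Embed $A$ in $\mathfrak W(X)$ by letting $a\in A$ act as $a(xw)=a(x)w$ for $x\in X$, $w\in X^*$. Embed $B$ in $\mathfrak W(X)$ by letting $b=(b_x)_{x\in\overline X}\,\sigma$ (with $b_x\in A$, $\sigma\in\mathrm{Sym}(\overline X)$) act recursively as $b(ow)=o\,b(w)$ and $b(xw)=\sigma(x)\,b_x(w)$ for $x\in\overline X$, $w\in X^*$, where $b_x\in A$ acts on $X^*$ as just described. The Mother group $\mathfrak M(X)=\langle A,B\rangle$ is the subgroup of $\mathfrak W(X)$ generated by the finite groups $A$ and $B$, regarded as a discrete group. *)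

theory Defs
  imports Complex_Main "HOL-Algebra.Generated_Groups" "HOL-Combinatorics.Permutations"
    "HOL-Library.FuncSet"
begin

text \<open>The alphabet is a finite type \<open>'x\<close>, and vertices of the tree are words of type \<open>'x list\<close>,
  with root \<open>[]\<close>. All products of maps are read from left to right (\<open>\<alpha>\<beta>\<close> is first \<open>\<alpha>\<close>, then \<open>\<beta>\<close>),
  so the group multiplications below are \<open>\<lambda>\<alpha> \<beta>. \<beta> \<circ> \<alpha>\<close>.\<close>

definition tree_adj :: "'x list \<Rightarrow> 'x list \<Rightarrow> bool" where
  "tree_adj u v \<longleftrightarrow> (\<exists>x. v = u @ [x] \<or> u = v @ [x])"

definition tree_aut :: "('x list \<Rightarrow> 'x list) monoid" where
  "tree_aut = \<lparr>carrier = {f. bij f \<and> f [] = [] \<and> (\<forall>u v. tree_adj (f u) (f v) \<longleftrightarrow> tree_adj u v)},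
     monoid.mult = (\<lambda>f g. g \<circ> f), monoid.one = id\<rparr>"

definition sym_on :: "'x set \<Rightarrow> ('x \<Rightarrow> 'x) monoid" where
  "sym_on S = \<lparr>carrier = {\<sigma>. \<sigma> permutes S}, monoid.mult = (\<lambda>\<sigma> \<tau>. \<tau> \<circ> \<sigma>), monoid.one = id\<rparr>"

abbreviation mother_A :: "('x \<Rightarrow> 'x) monoid" where
  "mother_A \<equiv> sym_on UNIV"

text \<open>The permutational wreath product of \<open>mother_A\<close> with the symmetric group of the alphabet
  without the distinguished letter \<open>x0\<close>; the element \<open>(b\<^sub>x)\<^sub>x \<sigma>\<close> is the pair \<open>(b, \<sigma>)\<close>.\<close>

definition mother_B :: "'x \<Rightarrow> (('x \<Rightarrow> 'x \<Rightarrow> 'x) \<times> ('x \<Rightarrow> 'x)) monoid" where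
  "mother_B x0 = \<lparr>
     carrier = (- {x0} \<rightarrow>\<^sub>E carrier mother_A) \<times> carrier (sym_on (- {x0})),
     monoid.mult = (\<lambda>(a, \<sigma>) (b, \<tau>).
       (\<lambda>x \<in> - {x0}. a x \<otimes>\<^bsub>mother_A\<^esub> b (\<sigma> x), \<sigma> \<otimes>\<^bsub>sym_on (- {x0})\<^esub> \<tau>)),
     monoid.one = (\<lambda>x \<in> - {x0}. \<one>\<^bsub>mother_A\<^esub>, \<one>\<^bsub>sym_on (- {x0})\<^esub>)\<rparr>"

fun act_A :: "('x \<Rightarrow> 'x) \<Rightarrow> 'x list \<Rightarrow> 'x list" where
  "act_A a [] = []"
| "act_A a (x # w) = a x # w"

fun act_B :: "'x \<Rightarrow> ('x \<Rightarrow> 'x \<Rightarrow> 'x) \<times> ('x \<Rightarrow> 'x) \<Rightarrow> 'x list \<Rightarrow> 'x list" where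
  "act_B x0 b [] = []"
| "act_B x0 b (x # w) = (if x = x0 then x0 # act_B x0 b w else snd b x # act_A (fst b x) w)"

definition mother_group :: "'x \<Rightarrow> ('x list \<Rightarrow> 'x list) monoid" where
  "mother_group x0 = tree_aut\<lparr>carrier :=
     generate tree_aut (act_A ` carrier mother_A \<union> act_B x0 ` carrier (mother_B x0))\<rparr>"

text \<open>Amenability of a discrete group: a left-invariant finitely additive probability measure
  defined on all subsets.\<close>

definition amenable :: "('a, 'b) monoid_scheme \<Rightarrow> bool" where
  "amenable G \<longleftrightarrow> group G \<and> (\<exists>\<mu> :: 'a set \<Rightarrow> real.
     (\<forall>S. S \<subseteq> carrier G \<longrightarrow> 0 \<le> \<mu> S) \<and>
     \<mu> (carrier G) = 1 \<and>
     (\<forall>S T. S \<subseteq> carrier G \<longrightarrow> T \<subseteq> carrier G \<longrightarrow> S \<inter> T = {} \<longrightarrow> \<mu> (S \<union> T) = \<mu> S + \<mu> T) \<and>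
     (\<forall>g \<in> carrier G. \<forall>S. S \<subseteq> carrier G \<longrightarrow> \<mu> (g <#\<^bsub>G\<^esub> S) = \<mu> S))"

text \<open>The following facts confirm that the objects above are groups and that \<open>act_A\<close> and \<open>act_B\<close>
  embed \<open>mother_A\<close> and \<open>mother_B\<close> into the automorphism group of the tree.\<close>

lemma group_tree_aut: "group tree_aut"
proof (rule groupI)
  fix f :: "'x list \<Rightarrow> 'x list"
  assume "f \<in> carrier tree_aut"
  then have f: "bij f" "f [] = []" "\<And>u v. tree_adj (f u) (f v) \<longleftrightarrow> tree_adj u v"
    by (auto simp: tree_aut_def)
  have fi: "f (inv_into UNIV f u) = u" for u
    using f(1) by (simp add: bij_is_surj surj_f_inv_f)
  have "inv_into UNIV f \<in> carrier tree_aut"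
    using f bij_imp_bij_inv[OF f(1)] inv_f_eq[OF bij_is_inj[OF f(1)] f(2)] fi
    by (simp add: tree_aut_def) (metis fi f(3))
  moreover have "inv_into UNIV f \<otimes>\<^bsub>tree_aut\<^esub> f = \<one>\<^bsub>tree_aut\<^esub>"
    by (auto simp: tree_aut_def fi)
  ultimately show "\<exists>g\<in>carrier tree_aut. g \<otimes>\<^bsub>tree_aut\<^esub> f = \<one>\<^bsub>tree_aut\<^esub>" by blast
qed (auto simp: tree_aut_def bij_comp comp_assoc)

lemma group_sym_on: "group (sym_on S)"
proof (rule groupI)
  fix \<sigma> assume "\<sigma> \<in> carrier (sym_on S)"
  then show "\<exists>\<tau>\<in>carrier (sym_on S). \<tau> \<otimes>\<^bsub>sym_on S\<^esub> \<sigma> = \<one>\<^bsub>sym_on S\<^esub>"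
    by (intro bexI[of _ "inv_into UNIV \<sigma>"]) (auto simp: sym_on_def permutes_inv permutes_inv_o)
qed (auto simp: sym_on_def permutes_compose permutes_id comp_assoc)

lemma length_act_A [simp]: "length (act_A a w) = length w"
  by (cases w) auto

lemma length_act_B [simp]: "length (act_B x0 b w) = length w"
  by (induction w) auto

lemma act_A_comp: "act_A c (act_A a w) = act_A (c \<circ> a) w"
  by (cases w) auto

lemma act_A_id: "act_A id w = w"
  by (cases w) auto

lemma act_A_snoc: "\<exists>y. act_A a (w @ [x]) = act_A a w @ [y]"
  by (cases w) auto

lemma act_B_snoc: "\<exists>y. act_B x0 b (w @ [x]) = act_B x0 b w @ [y]"
proof (induction w)
  case (Cons z w)
  then show ?case using act_A_snoc[of "fst b z" w x] by auto
qed auto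

lemma tree_autI:
  fixes f g :: "'x list \<Rightarrow> 'x list"
  assumes gf: "\<And>w. g (f w) = w" and fg: "\<And>w. f (g w) = w"
    and len: "\<And>w. length (f w) = length w"
    and f: "\<And>w x. \<exists>y. f (w @ [x]) = f w @ [y]"
    and g: "\<And>w x. \<exists>y. g (w @ [x]) = g w @ [y]"
  shows "f \<in> carrier tree_aut"
proof -
  have "bij f" by (rule o_bij[of g]) (auto simp: gf fg)
  moreover have "f [] = []" using len[of "[]"] by simp
  moreover have adj: "tree_adj (h u) (h v)"
    if "tree_adj u v" and h: "\<And>w x. \<exists>y. h (w @ [x]) = h w @ [y]"
    for u v and h :: "'x list \<Rightarrow> 'x list"
    using \<open>tree_adj u v\<close> h[of u] h[of v] unfolding tree_adj_def by blast
  have "tree_adj (f u) (f v) \<longleftrightarrow> tree_adj u v" for u v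
    using adj[of u v f] adj[of "f u" "f v" g] f g by (auto simp only: gf)
  ultimately show ?thesis by (simp add: tree_aut_def)
qed

lemma act_A_in_tree_aut:
  assumes "a \<in> carrier mother_A"
  shows "act_A a \<in> carrier tree_aut"
proof -
  have "a permutes UNIV" using assms by (simp add: sym_on_def)
  then show ?thesis
    by (intro tree_autI[where g = "act_A (inv_into UNIV a)"])
      (auto simp: act_A_comp act_A_id permutes_inv_o act_A_snoc)
qed

lemma act_A_hom: "act_A \<in> hom mother_A tree_aut"
  by (intro homI act_A_in_tree_aut) (auto simp: sym_on_def tree_aut_def act_A_comp)

lemma inj_act_A: "inj act_A"
proof (rule injI, rule ext)
  fix a b :: "'x \<Rightarrow> 'x" and x assume "act_A a = act_A b"
  then have "act_A a [x] = act_A b [x]" by simp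
  then show "a x = b x" by simp
qed

lemma mother_B_snd:
  assumes "p \<in> carrier (mother_B x0)" "x \<noteq> x0"
  shows "snd p x \<noteq> x0"
  using assms permutes_in_image[of "snd p" "- {x0}" x]
  by (cases p) (simp add: mother_B_def sym_on_def)

lemma mother_B_mult_closed:
  assumes p: "p \<in> carrier (mother_B x0)" and q: "q \<in> carrier (mother_B x0)"
  shows "p \<otimes>\<^bsub>mother_B x0\<^esub> q \<in> carrier (mother_B x0)"
proof -
  obtain a \<sigma> b \<tau> where pq: "p = (a, \<sigma>)" "q = (b, \<tau>)" by (cases p, cases q)
  have a: "a x permutes UNIV" and b: "b x permutes UNIV" if "x \<noteq> x0" for x
    using p q that by (simp_all add: pq mother_B_def sym_on_def PiE_iff)
  have s: "\<sigma> permutes - {x0}" "\<tau> permutes - {x0}"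
    using p q by (simp_all add: pq mother_B_def sym_on_def)
  have "b (\<sigma> x) \<circ> a x permutes UNIV" if "x \<noteq> x0" for x
    using a[OF that] b[of "\<sigma> x"] mother_B_snd[OF p that] by (simp add: pq permutes_compose)
  then show ?thesis
    using permutes_compose[OF s] by (simp add: pq mother_B_def sym_on_def)
qed

lemma group_mother_B: "group (mother_B x0)"
proof (rule groupI)
  fix p assume "p \<in> carrier (mother_B x0)"
  then obtain a \<sigma> where p: "p = (a, \<sigma>)" and a: "a \<in> - {x0} \<rightarrow>\<^sub>E {a. a permutes UNIV}"
    and \<sigma>: "\<sigma> permutes (- {x0})"
    by (auto simp: mother_B_def sym_on_def)
  define q where "q = ((\<lambda>x\<in>- {x0}. inv_into UNIV (a (inv_into UNIV \<sigma> x))), inv_into UNIV \<sigma>)"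
  have ne: "inv_into UNIV \<sigma> x \<noteq> x0" if "x \<noteq> x0" for x
    using permutes_in_image[OF permutes_inv[OF \<sigma>], of x] that by simp
  then have aperm: "a (inv_into UNIV \<sigma> x) permutes UNIV" if "x \<noteq> x0" for x
    using a that by (auto simp: PiE_iff)
  have "q \<in> carrier (mother_B x0)"
    using aperm permutes_inv[OF \<sigma>] by (auto simp: q_def mother_B_def sym_on_def permutes_inv)
  moreover have "q \<otimes>\<^bsub>mother_B x0\<^esub> p = \<one>\<^bsub>mother_B x0\<^esub>"
    using permutes_inv_o[OF \<sigma>] permutes_inv_o[OF aperm]
    by (auto simp: q_def p mother_B_def sym_on_def intro!: restrict_ext)
  ultimately show "\<exists>q\<in>carrier (mother_B x0). q \<otimes>\<^bsub>mother_B x0\<^esub> p = \<one>\<^bsub>mother_B x0\<^esub>" by blast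
next
  fix p q assume "p \<in> carrier (mother_B x0)" "q \<in> carrier (mother_B x0)"
  then show "p \<otimes>\<^bsub>mother_B x0\<^esub> q \<in> carrier (mother_B x0)"
    by (intro mother_B_mult_closed)
next
  fix p q r
  assume pqr: "p \<in> carrier (mother_B x0)" "q \<in> carrier (mother_B x0)" "r \<in> carrier (mother_B x0)"
  then have "snd p x \<noteq> x0" if "x \<noteq> x0" for x
    using that by (intro mother_B_snd)
  then show "p \<otimes>\<^bsub>mother_B x0\<^esub> q \<otimes>\<^bsub>mother_B x0\<^esub> r = p \<otimes>\<^bsub>mother_B x0\<^esub> (q \<otimes>\<^bsub>mother_B x0\<^esub> r)"
    by (simp add: mother_B_def sym_on_def comp_assoc case_prod_unfold fun_eq_iff)
next
  show "\<one>\<^bsub>mother_B x0\<^esub> \<in> carrier (mother_B x0)"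
    by (simp add: mother_B_def sym_on_def permutes_id)
next
  fix p assume "p \<in> carrier (mother_B x0)"
  then have "fst p x0 = undefined"
    by (cases p) (simp add: mother_B_def PiE_iff extensional_def)
  then show "\<one>\<^bsub>mother_B x0\<^esub> \<otimes>\<^bsub>mother_B x0\<^esub> p = p"
    by (cases p) (simp add: mother_B_def sym_on_def restrict_def fun_eq_iff)
qed

lemma act_B_mult:
  assumes "p \<in> carrier (mother_B x0)" "q \<in> carrier (mother_B x0)"
  shows "act_B x0 (p \<otimes>\<^bsub>mother_B x0\<^esub> q) w = act_B x0 q (act_B x0 p w)"
proof (induction w)
  case (Cons x w)
  have "snd p x \<noteq> x0" if "x \<noteq> x0"
    using mother_B_snd[OF assms(1) that] .
  then show ?case using Cons
    by (auto simp: mother_B_def sym_on_def act_A_comp split: prod.splits)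
qed auto

lemma act_B_one: "act_B x0 \<one>\<^bsub>mother_B x0\<^esub> w = w"
  by (induction w) (auto simp: mother_B_def sym_on_def act_A_id)

lemma act_B_in_tree_aut:
  assumes p: "p \<in> carrier (mother_B x0)"
  shows "act_B x0 p \<in> carrier tree_aut"
proof -
  interpret B: group "mother_B x0" by (rule group_mother_B)
  show ?thesis
    by (rule tree_autI[where g = "act_B x0 (inv\<^bsub>mother_B x0\<^esub> p)"])
      (use p in \<open>auto simp: act_B_mult[symmetric] act_B_one act_B_snoc\<close>)
qed

lemma act_B_hom: "act_B x0 \<in> hom (mother_B x0) tree_aut"
  by (intro homI act_B_in_tree_aut) (auto simp: tree_aut_def act_B_mult)

lemma inj_on_act_B: "inj_on (act_B x0) (carrier (mother_B x0))"
proof (rule inj_onI)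
  fix p q assume pq: "p \<in> carrier (mother_B x0)" "q \<in> carrier (mother_B x0)"
    and eq: "act_B x0 p = act_B x0 q"
  have 1: "act_B x0 p [x, y] = act_B x0 q [x, y]" for x y using eq by simp
  have s: "snd p x = snd q x" and f: "fst p x y = fst q x y" if "x \<noteq> x0" for x y
    using 1[of x y] that by auto
  have p0: "snd p x0 = x0" "fst p x0 = undefined" if "p \<in> carrier (mother_B x0)" for p
    using that permutes_not_in[of "snd p" "- {x0}" x0]
    by (cases p; simp add: mother_B_def sym_on_def PiE_iff extensional_def)+
  have "snd p x = snd q x" for x
    using s[of x] p0(1)[OF pq(1)] p0(1)[OF pq(2)] by (cases "x = x0") simp_all
  moreover have "fst p x = fst q x" for x
    using f[of x] p0(2)[OF pq(1)] p0(2)[OF pq(2)] by (cases "x = x0") (simp_all add: fun_eq_iff)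
  ultimately show "p = q" by (intro prod_eqI ext) auto
qed

lemma group_mother_group: "group (mother_group x0)"
proof -
  interpret W: group tree_aut by (rule group_tree_aut)
  show ?thesis unfolding mother_group_def
    by (intro W.subgroup_imp_group W.generate_is_subgroup)
      (auto simp: act_A_in_tree_aut act_B_in_tree_aut)
qed

end

theory Submission
  imports Defs "HOL-Probability.Product_PMF"
begin

text \<open>Let \<open>u n\<close> be the Shannon entropy of \<open>\<lambda>\<^sub>n = m\<^sub>A (m\<^sub>B m\<^sub>A)\<^sup>n\<close>, a product of convolutions of the uniform
  measures on \<open>A\<close> and \<open>B\<close>. The section of a \<open>\<lambda>\<^sub>n\<close>-random element at any letter has the law of the
  \<open>n\<close>-th convolution power of \<open>(1/d) m\<^sub>B + (1 - 1/d) m\<^sub>A\<close>, where \<open>d\<close> is the size of the alphabet.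
  As \<open>m\<^sub>A\<close> and \<open>m\<^sub>B\<close> are idempotent, this power is a mixture of measures \<open>\<lambda>\<^sub>k\<close> (up to the ends), with
  mean value of \<open>k\<close> about \<open>n (1 - 1/d) / d\<close>. An element is determined by its \<open>d\<close> sections and its action
  on letters, so the growth rate \<open>h\<close> of \<open>u\<close> satisfies \<open>h \<le> (1 - 1/d) h\<close> and vanishes. Hence some
  increments \<open>u (n + 1) - u n\<close> are arbitrarily small. Such an increment bounds the mean relative entropy
  of the translates of \<open>\<lambda>\<^sub>n\<close> by \<open>B\<close> with respect to \<open>m\<^sub>B \<lambda>\<^sub>n\<close>, which makes \<open>\<lambda>\<^sub>n\<close> almost invariant,
  and a cluster point of these measures is an invariant mean.\<close>

section \<open>Shannon entropy\<close>

text \<open>Meaningful for finite support only: otherwise the sum is \<open>0\<close>.\<close>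

definition shannon :: "'a pmf \<Rightarrow> real" where
  "shannon p = (\<Sum>x\<in>set_pmf p. - pmf p x * ln (pmf p x))"

lemma shannon_nonneg: "0 \<le> shannon p"
  unfolding shannon_def
  by (intro sum_nonneg) (simp add: mult_nonneg_nonpos pmf_le_1 pmf_positive)

text \<open>Apply \<open>ln t \<le> t - 1\<close> at \<open>t = q x / pmf p x\<close>, weight by
  \<open>pmf p x\<close> and sum. The weights \<open>q\<close> need total mass at most 1 only on the
  support of \<open>p\<close>, which suits both constant weights and products of marginals.\<close>

lemma gibbs_inequality:
  assumes "finite (set_pmf p)" and q: "\<And>x. x \<in> set_pmf p \<Longrightarrow> 0 < q x"
    and sum: "(\<Sum>x\<in>set_pmf p. q x) \<le> 1"
  shows "shannon p \<le> (\<Sum>x\<in>set_pmf p. - pmf p x * ln (q x))"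
proof -
  have "pmf p x * (ln (q x) - ln (pmf p x)) \<le> q x - pmf p x" if "x \<in> set_pmf p" for x
  proof -
    have p: "0 < pmf p x" using that by (rule pmf_positive)
    have "ln (q x / pmf p x) \<le> q x / pmf p x - 1"
      using p q[OF that] by (intro ln_le_minus_one) simp
    then have "pmf p x * ln (q x / pmf p x) \<le> pmf p x * (q x / pmf p x - 1)"
      using p by (intro mult_left_mono) auto
    also have "\<dots> = q x - pmf p x" using p by (simp add: field_simps)
    finally show ?thesis using p q[OF that] by (simp add: ln_div)
  qed
  then have "(\<Sum>x\<in>set_pmf p. pmf p x * (ln (q x) - ln (pmf p x))) \<le> (\<Sum>x\<in>set_pmf p. q x - pmf p x)"
    by (rule sum_mono)
  also have "\<dots> \<le> 0" using sum sum_pmf_eq_1[OF assms(1) order_refl] by (simp add: sum_subtractf)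
  finally show ?thesis
    by (simp add: shannon_def algebra_simps sum_subtractf sum_negf)
qed

lemma shannon_le_ln_card:
  assumes "finite S" "set_pmf p \<subseteq> S"
  shows "shannon p \<le> ln (real (card S))"
proof -
  have fin: "finite (set_pmf p)" using assms finite_subset by blast
  have "card S \<noteq> 0" using assms set_pmf_not_empty[of p] by auto
  then have S: "0 < real (card S)" by simp
  have "real (card (set_pmf p)) / real (card S) \<le> 1"
    using card_mono[OF assms] S by simp
  then have "shannon p \<le> (\<Sum>x\<in>set_pmf p. - pmf p x * ln (1 / real (card S)))"
    using S by (intro gibbs_inequality fin) auto
  also have "\<dots> = ln (real (card S))"
    using S sum_pmf_eq_1[OF fin order_refl]
    by (simp add: ln_div sum_distrib_right[symmetric])
  finally show ?thesis .
qed

lemma expectation_finite: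
  fixes F :: "'a \<Rightarrow> real"
  assumes "finite (set_pmf p)"
  shows "measure_pmf.expectation p F = (\<Sum>x\<in>set_pmf p. pmf p x * F x)"
  using integral_measure_pmf[OF assms, of p F] by simp

lemma sum_map_pmf:
  fixes F :: "'b \<Rightarrow> real"
  assumes "finite (set_pmf p)"
  shows "(\<Sum>y\<in>set_pmf (map_pmf f p). pmf (map_pmf f p) y * F y) = (\<Sum>x\<in>set_pmf p. pmf p x * F (f x))"
proof -
  have "finite (set_pmf (map_pmf f p))" using assms by simp
  from expectation_finite[OF this, of F] expectation_finite[OF assms, of "\<lambda>x. F (f x)"]
  show ?thesis by simp
qed

text \<open>The \<open>f i\<close> are the coordinates of a joint distribution, so this contains subadditivity.\<close>

lemma shannon_le_sum_coordinates:
  assumes I: "finite I" and fin: "finite (set_pmf p)"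
    and inj: "\<And>x y. x \<in> set_pmf p \<Longrightarrow> y \<in> set_pmf p \<Longrightarrow> (\<And>i. i \<in> I \<Longrightarrow> f i x = f i y) \<Longrightarrow> x = y"
  shows "shannon p \<le> (\<Sum>i\<in>I. shannon (map_pmf (f i) p))"
proof -
  define q where "q = (\<lambda>i. pmf (map_pmf (f i) p))"
  have q_pos: "0 < q i (f i x)" if "x \<in> set_pmf p" for i x
    using that by (auto simp: q_def intro!: pmf_positive)
  have inj': "inj_on (\<lambda>x. restrict (\<lambda>i. f i x) I) (set_pmf p)"
    by (intro inj_onI inj) (auto dest!: fun_cong simp: restrict_def split: if_splits)
  \<comment> \<open>The product of the marginals is an admissible weight for Gibbs: the support of
    \<open>p\<close> embeds into the product of the marginal supports, and over that whole product
    the sum factorizes into factors equal to 1.\<close>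
  have "(\<Sum>x\<in>set_pmf p. \<Prod>i\<in>I. q i (f i x))
      = (\<Sum>\<phi>\<in>(\<lambda>x. restrict (\<lambda>i. f i x) I) ` set_pmf p. \<Prod>i\<in>I. q i (\<phi> i))"
    by (subst sum.reindex[OF inj']) (auto intro!: sum.cong prod.cong)
  also have "\<dots> \<le> (\<Sum>\<phi>\<in>PiE I (\<lambda>i. f i ` set_pmf p). \<Prod>i\<in>I. q i (\<phi> i))"
    using I fin by (intro sum_mono2 finite_PiE) (auto simp: q_def prod_nonneg)
  also have "\<dots> = (\<Prod>i\<in>I. \<Sum>y\<in>f i ` set_pmf p. q i y)"
    using I fin by (subst prod_sum_PiE) auto
  also have "\<dots> = 1"
    using fin by (intro prod.neutral ballI) (simp add: q_def sum_pmf_eq_1)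
  finally have "shannon p \<le> (\<Sum>x\<in>set_pmf p. - pmf p x * ln (\<Prod>i\<in>I. q i (f i x)))"
    using q_pos by (intro gibbs_inequality fin prod_pos) auto
  also have "\<dots> = (\<Sum>x\<in>set_pmf p. \<Sum>i\<in>I. pmf p x * (- ln (q i (f i x))))"
    using q_pos by (intro sum.cong refl) (simp add: ln_prod I sum_distrib_left sum_negf order_less_imp_not_eq2 less_imp_neq)
  also have "\<dots> = (\<Sum>i\<in>I. \<Sum>x\<in>set_pmf p. pmf p x * (- ln (q i (f i x))))"
    by (rule sum.swap)
  also have "\<dots> = (\<Sum>i\<in>I. shannon (map_pmf (f i) p))"
  proof (rule sum.cong[OF refl])
    fix i
    show "(\<Sum>x\<in>set_pmf p. pmf p x * (- ln (q i (f i x)))) = shannon (map_pmf (f i) p)"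
      using sum_map_pmf[OF fin, of "f i" "\<lambda>y. - ln (q i y)"] by (simp add: shannon_def q_def)
  qed
  finally show ?thesis .
qed

lemma shannon_map_inj:
  assumes "inj_on f (set_pmf p)"
  shows "shannon (map_pmf f p) = shannon p"
  unfolding shannon_def using assms
  by (simp add: sum.reindex pmf_map_inj)

text \<open>The mean cross entropy of the components relative to the mixture. The upper and the
  lower bound for the entropy of a mixture both start from this form.\<close>

lemma shannon_bind_eq:
  assumes fin: "finite (set_pmf p)" "\<forall>x\<in>set_pmf p. finite (set_pmf (f x))"
  shows "shannon (bind_pmf p f) =
    (\<Sum>x\<in>set_pmf p. pmf p x * (\<Sum>y\<in>set_pmf (f x). pmf (f x) y * (- ln (pmf (bind_pmf p f) y))))"
proof -
  let ?F = "\<lambda>y. - ln (pmf (bind_pmf p f) y)"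
  have fin': "finite (set_pmf (bind_pmf p f))" using fin by simp
  have "shannon (bind_pmf p f) = measure_pmf.expectation (bind_pmf p f) ?F"
    unfolding expectation_finite[OF fin'] shannon_def by simp
  also have "\<dots> = (\<Sum>x\<in>set_pmf p. pmf p x *\<^sub>R measure_pmf.expectation (f x) ?F)"
    using fin by (intro pmf_expectation_bind) auto
  also have "\<dots> = (\<Sum>x\<in>set_pmf p. pmf p x * (\<Sum>y\<in>set_pmf (f x). pmf (f x) y * ?F y))"
    by (intro sum.cong refl) (simp only: expectation_finite[OF bspec[OF fin(2)]] real_scaleR_def)
  finally show ?thesis .
qed

lemma pmf_bind_ge:
  assumes "finite (set_pmf p)" "x \<in> set_pmf p"
  shows "pmf p x * pmf (f x) y \<le> pmf (bind_pmf p f) y"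
proof -
  have "pmf (bind_pmf p f) y = (\<Sum>z\<in>set_pmf p. pmf p z * pmf (f z) y)"
    using assms(1) by (simp add: pmf_bind integral_measure_pmf[of "set_pmf p"])
  then show ?thesis
    using assms member_le_sum[of x "set_pmf p" "\<lambda>z. pmf p z * pmf (f z) y"] by simp
qed

text \<open>By \<open>pmf_bind_ge\<close> the mixture has at least the mass
  \<open>pmf p x * pmf (f x) y\<close> at \<open>y\<close>, so each cross entropy splits into
  \<open>- ln (pmf p x)\<close> and the entropy of \<open>f x\<close>.\<close>

lemma shannon_bind_le:
  assumes fin: "finite (set_pmf p)" "\<And>x. x \<in> set_pmf p \<Longrightarrow> finite (set_pmf (f x))"
  shows "shannon (bind_pmf p f) \<le> shannon p + (\<Sum>x\<in>set_pmf p. pmf p x * shannon (f x))"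
proof -
  have fin': "\<forall>x\<in>set_pmf p. finite (set_pmf (f x))" using fin(2) by blast
  have "(\<Sum>y\<in>set_pmf (f x). pmf (f x) y * (- ln (pmf (bind_pmf p f) y)))
      \<le> - ln (pmf p x) + shannon (f x)" if x: "x \<in> set_pmf p" for x
  proof -
    have "(\<Sum>y\<in>set_pmf (f x). pmf (f x) y * (- ln (pmf (bind_pmf p f) y)))
        \<le> (\<Sum>y\<in>set_pmf (f x). pmf (f x) y * (- ln (pmf p x) - ln (pmf (f x) y)))"
    proof (intro sum_mono mult_left_mono)
      fix y assume y: "y \<in> set_pmf (f x)"
      have pos: "0 < pmf p x" "0 < pmf (f x) y" using x y by (auto intro: pmf_positive)
      then have "ln (pmf p x * pmf (f x) y) \<le> ln (pmf (bind_pmf p f) y)"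
        using pmf_bind_ge[OF fin(1) x, of f y] by (intro ln_mono) auto
      then show "- ln (pmf (bind_pmf p f) y) \<le> - ln (pmf p x) - ln (pmf (f x) y)"
        using pos by (simp add: ln_mult)
    qed simp
    also have "\<dots> = - ln (pmf p x) * (\<Sum>y\<in>set_pmf (f x). pmf (f x) y) + shannon (f x)"
      by (simp add: shannon_def algebra_simps sum_subtractf sum_negf sum_distrib_left)
    finally show ?thesis using sum_pmf_eq_1[OF fin(2)[OF x] order_refl] by simp
  qed
  then have "shannon (bind_pmf p f) \<le> (\<Sum>x\<in>set_pmf p. pmf p x * (- ln (pmf p x) + shannon (f x)))"
    unfolding shannon_bind_eq[OF fin(1) fin'] by (intro sum_mono mult_left_mono) auto
  then show ?thesis by (simp add: shannon_def algebra_simps sum_subtractf sum.distrib sum_negf)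
qed

section \<open>Relative entropy and strict concavity of the entropy\<close>

text \<open>A substitute for Pinsker's inequality: \<open>ln t \<le> t - 1\<close> at \<open>t = sqrt (q y / p y)\<close> bounds the
  squared Hellinger distance by the relative entropy, and Cauchy-Schwarz passes to total variation.\<close>

lemma measure_diff_le_relative_entropy:
  assumes fin: "finite (set_pmf q)" and sub: "set_pmf p \<subseteq> set_pmf q"
  shows "(measure p S - measure q S)\<^sup>2
    \<le> 4 * (\<Sum>y\<in>set_pmf p. pmf p y * (ln (pmf p y) - ln (pmf q y)))"
proof -
  let ?Q = "set_pmf q"
  define a b where "a = (\<lambda>y. sqrt (pmf p y))" and "b = (\<lambda>y. sqrt (pmf q y))"
  have finp: "finite (set_pmf p)" using fin sub finite_subset by blast
  have sq: "(a y)\<^sup>2 = pmf p y" "(b y)\<^sup>2 = pmf q y" for y by (simp_all add: a_def b_def)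
  have sums: "(\<Sum>y\<in>?Q. pmf p y) = 1" "(\<Sum>y\<in>?Q. pmf q y) = 1"
    using sum_pmf_eq_1[OF fin] sub by auto
  have rel: "(\<Sum>y\<in>set_pmf p. pmf p y * (ln (pmf p y) - ln (pmf q y)))
      = (\<Sum>y\<in>?Q. pmf p y * (ln (pmf p y) - ln (pmf q y)))"
    by (rule sum.mono_neutral_left[OF fin sub]) (auto simp: set_pmf_iff)
  \<comment> \<open>Both measures have mass 1 on \<open>?Q\<close>, so the left side is
    \<open>2 - 2 * (\<Sum>y\<in>?Q. a y * b y)\<close>, the squared Hellinger distance.\<close>
  have "(\<Sum>y\<in>?Q. 2 * pmf p y - 2 * (a y * b y)) \<le> (\<Sum>y\<in>?Q. pmf p y * (ln (pmf p y) - ln (pmf q y)))"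
  proof (rule sum_mono)
    fix y assume "y \<in> ?Q"
    then have b: "0 < b y" by (auto simp: b_def pmf_positive)
    show "2 * pmf p y - 2 * (a y * b y) \<le> pmf p y * (ln (pmf p y) - ln (pmf q y))"
    proof (cases "y \<in> set_pmf p")
      case False
      then show ?thesis by (simp add: a_def set_pmf_iff)
    next
      case True
      then have a: "0 < a y" by (auto simp: a_def pmf_positive)
      have "ln (b y / a y) \<le> b y / a y - 1" using a b by (intro ln_le_minus_one) simp
      then have "(a y)\<^sup>2 * (ln (b y) - ln (a y)) \<le> (a y)\<^sup>2 * (b y / a y - 1)"
        using a b by (intro mult_left_mono) (auto simp: ln_div)
      also have "\<dots> = a y * b y - (a y)\<^sup>2" using a by (simp add: field_simps power2_eq_square)
      finally have "2 * (a y)\<^sup>2 - 2 * (a y * b y) \<le> (a y)\<^sup>2 * (2 * ln (a y) - 2 * ln (b y))"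
        by (simp add: algebra_simps)
      moreover have "ln (pmf p y) = 2 * ln (a y)" "ln (pmf q y) = 2 * ln (b y)"
        unfolding sq[symmetric] using a b by (simp_all add: ln_realpow)
      ultimately show ?thesis by (simp add: sq)
    qed
  qed
  then have hell: "(\<Sum>y\<in>?Q. (a y - b y)\<^sup>2) \<le> (\<Sum>y\<in>?Q. pmf p y * (ln (pmf p y) - ln (pmf q y)))"
    using sums by (simp add: power2_diff sq sum_subtractf sum.distrib sum_distrib_left mult.assoc flip: sum_distrib_left)
  have ms: "measure r S = (\<Sum>y\<in>?Q \<inter> S. pmf r y)" if "set_pmf r \<subseteq> ?Q" for r
  proof -
    have "measure r S = measure r (?Q \<inter> S)"
      using that by (intro measure_pmf.finite_measure_eq_AE) (auto simp: AE_measure_pmf_iff)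
    then show ?thesis using fin by (simp add: measure_measure_pmf_finite)
  qed
  have "\<bar>measure p S - measure q S\<bar> \<le> (\<Sum>y\<in>?Q \<inter> S. \<bar>pmf p y - pmf q y\<bar>)"
    using ms[OF sub] ms[OF order_refl] sum_abs[of "\<lambda>y. pmf p y - pmf q y" "?Q \<inter> S"]
    by (simp add: sum_subtractf)
  also have "\<dots> \<le> (\<Sum>y\<in>?Q. \<bar>pmf p y - pmf q y\<bar>)"
    using fin by (intro sum_mono2) auto
  also have "\<dots> = (\<Sum>y\<in>?Q. \<bar>a y - b y\<bar> * (a y + b y))"
  proof (rule sum.cong[OF refl])
    fix y
    have "0 \<le> a y + b y" by (simp add: a_def b_def)
    moreover have "pmf p y - pmf q y = (a y - b y) * (a y + b y)"
      by (simp add: sq[symmetric] power2_eq_square algebra_simps)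
    ultimately show "\<bar>pmf p y - pmf q y\<bar> = \<bar>a y - b y\<bar> * (a y + b y)" by (simp add: abs_mult)
  qed
  finally have "(measure p S - measure q S)\<^sup>2 \<le> (\<Sum>y\<in>?Q. \<bar>a y - b y\<bar> * (a y + b y))\<^sup>2"
    by (metis abs_ge_zero power2_abs power_mono)
  also have "\<dots> \<le> (\<Sum>y\<in>?Q. (a y - b y)\<^sup>2) * (\<Sum>y\<in>?Q. (a y + b y)\<^sup>2)"
    using Cauchy_Schwarz_ineq_sum[of "\<lambda>y. \<bar>a y - b y\<bar>" "\<lambda>y. a y + b y" ?Q] by simp
  also have "\<dots> \<le> (\<Sum>y\<in>?Q. (a y - b y)\<^sup>2) * 4"
  proof (intro mult_left_mono sum_nonneg)
    have "(\<Sum>y\<in>?Q. (a y + b y)\<^sup>2) \<le> (\<Sum>y\<in>?Q. 2 * pmf p y + 2 * pmf q y)"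
    proof (rule sum_mono)
      fix y
      have "(a y + b y)\<^sup>2 + (a y - b y)\<^sup>2 = 2 * (a y)\<^sup>2 + 2 * (b y)\<^sup>2"
        by (simp add: power2_eq_square algebra_simps)
      then show "(a y + b y)\<^sup>2 \<le> 2 * pmf p y + 2 * pmf q y"
        unfolding sq using zero_le_power2[of "a y - b y"] by linarith
    qed
    also have "\<dots> = 4" using sums by (simp add: sum.distrib flip: sum_distrib_left)
    finally show "(\<Sum>y\<in>?Q. (a y + b y)\<^sup>2) \<le> 4" .
  qed simp
  finally show ?thesis using hell rel by simp
qed

text \<open>The cross entropy of \<open>f x\<close> relative to the mixture exceeds the entropy of
  \<open>f x\<close> by their relative entropy. The deviation of \<open>f x\<close> from the mixture
  on a single set \<open>S\<close> therefore yields a quantitative gain in concavity.\<close>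

lemma shannon_bind_ge:
  assumes fin: "finite (set_pmf p)" "\<And>x. x \<in> set_pmf p \<Longrightarrow> finite (set_pmf (f x))"
  shows "(\<Sum>x\<in>set_pmf p. pmf p x * (shannon (f x) + (measure (f x) S - measure (bind_pmf p f) S)\<^sup>2 / 4))
    \<le> shannon (bind_pmf p f)"
proof -
  have fin': "\<forall>x\<in>set_pmf p. finite (set_pmf (f x))" using fin(2) by blast
  show ?thesis
    unfolding shannon_bind_eq[OF fin(1) fin']
  proof (intro sum_mono mult_left_mono)
    fix x assume x: "x \<in> set_pmf p"
    have "(measure (f x) S - measure (bind_pmf p f) S)\<^sup>2
        \<le> 4 * (\<Sum>y\<in>set_pmf (f x). pmf (f x) y * (ln (pmf (f x) y) - ln (pmf (bind_pmf p f) y)))"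
      using fin x by (intro measure_diff_le_relative_entropy) auto
    then show "shannon (f x) + (measure (f x) S - measure (bind_pmf p f) S)\<^sup>2 / 4
        \<le> (\<Sum>y\<in>set_pmf (f x). pmf (f x) y * (- ln (pmf (bind_pmf p f) y)))"
      by (simp add: shannon_def algebra_simps sum_subtractf sum_negf)
  qed auto
qed

section \<open>Convolution of finitely supported measures\<close>

text \<open>The composition \<open>h \<circ> g\<close> agrees with the left-to-right group product,
  so the first factor acts first.\<close>

definition conv_pmf :: "('a \<Rightarrow> 'a) pmf \<Rightarrow> ('a \<Rightarrow> 'a) pmf \<Rightarrow> ('a \<Rightarrow> 'a) pmf" (infixl "\<star>" 70) where
  "p \<star> q = bind_pmf p (\<lambda>g. map_pmf (\<lambda>h. h \<circ> g) q)"

lemma conv_assoc: "p \<star> q \<star> r = p \<star> (q \<star> r)"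
  by (simp add: conv_pmf_def bind_assoc_pmf map_bind_pmf bind_map_pmf pmf.map_comp comp_def)

lemma conv_return_right: "p \<star> return_pmf id = p"
  by (simp add: conv_pmf_def bind_return_pmf')

lemma conv_bind_left: "bind_pmf p f \<star> q = bind_pmf p (\<lambda>x. f x \<star> q)"
  by (simp add: conv_pmf_def bind_assoc_pmf)

lemma conv_bind_right: "p \<star> bind_pmf q f = bind_pmf q (\<lambda>x. p \<star> f x)"
  unfolding conv_pmf_def map_bind_pmf by (rule bind_commute_pmf)

lemma set_conv: "set_pmf (p \<star> q) = (\<Union>g\<in>set_pmf p. (\<lambda>h. h \<circ> g) ` set_pmf q)"
  by (auto simp: conv_pmf_def)

lemma finite_set_conv:
  "finite (set_pmf p) \<Longrightarrow> finite (set_pmf q) \<Longrightarrow> finite (set_pmf (p \<star> q))"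
  by (simp add: set_conv)

lemma shannon_translate:
  assumes "surj g"
  shows "shannon (map_pmf (\<lambda>h. h \<circ> g) p) = shannon p"
proof (rule shannon_map_inj, rule inj_onI)
  fix h k assume "h \<circ> g = k \<circ> g"
  then show "h = k" using assms by (metis surj_fun_eq UNIV_I fun_eq_iff comp_apply surjD)
qed

lemma sum_pmf_const:
  assumes "finite (set_pmf p)"
  shows "(\<Sum>x\<in>set_pmf p. pmf p x * c) = (c :: real)"
  using sum_pmf_eq_1[OF assms order_refl] by (simp flip: sum_distrib_right)

lemma shannon_conv_le:
  assumes fin: "finite (set_pmf p)" "finite (set_pmf q)" and surj: "\<And>g. g \<in> set_pmf p \<Longrightarrow> surj g"
  shows "shannon (p \<star> q) \<le> shannon p + shannon q"
proof -
  have "shannon (p \<star> q) \<le> shannon p + (\<Sum>g\<in>set_pmf p. pmf p g * shannon (map_pmf (\<lambda>h. h \<circ> g) q))"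
    unfolding conv_pmf_def using fin by (intro shannon_bind_le) auto
  also have "(\<Sum>g\<in>set_pmf p. pmf p g * shannon (map_pmf (\<lambda>h. h \<circ> g) q)) = (\<Sum>g\<in>set_pmf p. pmf p g * shannon q)"
    by (intro sum.cong refl) (simp add: shannon_translate surj)
  finally show ?thesis using sum_pmf_const[OF fin(1)] by simp
qed

text \<open>Given the first factor \<open>g\<close>, the law is a translate of \<open>q\<close>,
  with the same entropy as \<open>q\<close>. The squared terms record how far the translates are
  from their average \<open>p \<star> q\<close>; a small entropy gain thus forces almost
  invariance.\<close>

lemma shannon_conv_ge:
  assumes fin: "finite (set_pmf p)" "finite (set_pmf q)" and surj: "\<And>g. g \<in> set_pmf p \<Longrightarrow> surj g"
  shows "shannon q + (\<Sum>g\<in>set_pmf p. pmf p g * (measure q ((\<lambda>h. h \<circ> g) -` S) - measure (p \<star> q) S)\<^sup>2 / 4)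
    \<le> shannon (p \<star> q)"
proof -
  have "(\<Sum>g\<in>set_pmf p. pmf p g * (shannon (map_pmf (\<lambda>h. h \<circ> g) q)
      + (measure (map_pmf (\<lambda>h. h \<circ> g) q) S - measure (p \<star> q) S)\<^sup>2 / 4)) \<le> shannon (p \<star> q)"
    unfolding conv_pmf_def using fin by (intro shannon_bind_ge) auto
  also have "(\<Sum>g\<in>set_pmf p. pmf p g * (shannon (map_pmf (\<lambda>h. h \<circ> g) q)
      + (measure (map_pmf (\<lambda>h. h \<circ> g) q) S - measure (p \<star> q) S)\<^sup>2 / 4))
      = (\<Sum>g\<in>set_pmf p. pmf p g * shannon q
          + pmf p g * (measure q ((\<lambda>h. h \<circ> g) -` S) - measure (p \<star> q) S)\<^sup>2 / 4)"
    by (intro sum.cong refl) (simp add: shannon_translate surj distrib_left)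
  finally show ?thesis using sum_pmf_const[OF fin(1)] by (simp add: sum.distrib)
qed

lemma shannon_conv_ge_right:
  assumes fin: "finite (set_pmf p)" "finite (set_pmf q)" and surj: "\<And>g. g \<in> set_pmf p \<Longrightarrow> surj g"
  shows "shannon q \<le> shannon (p \<star> q)"
proof -
  have "0 \<le> (\<Sum>g\<in>set_pmf p. pmf p g * (measure q ((\<lambda>h. h \<circ> g) -` {}) - measure (p \<star> q) {})\<^sup>2 / 4)"
    by (intro sum_nonneg) simp
  then show ?thesis using shannon_conv_ge[OF assms, of "{}"] by linarith
qed

text \<open>Here the condition is on the second factor: for fixed \<open>h\<close> the law is the
  image of \<open>p\<close> under \<open>g \<mapsto> h \<circ> g\<close>, which is injective. With
  the test set \<open>{}\<close> the squared terms vanish.\<close>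

lemma shannon_conv_ge_left:
  assumes fin: "finite (set_pmf p)" "finite (set_pmf q)" and inj: "\<And>g. g \<in> set_pmf q \<Longrightarrow> inj g"
  shows "shannon p \<le> shannon (p \<star> q)"
proof -
  have eq: "p \<star> q = bind_pmf q (\<lambda>h. map_pmf (\<lambda>g. h \<circ> g) p)"
    unfolding conv_pmf_def map_pmf_def by (rule bind_commute_pmf)
  have "shannon p = (\<Sum>h\<in>set_pmf q. pmf q h * shannon p)"
    using sum_pmf_const[OF fin(2)] by simp
  also have "\<dots> \<le> (\<Sum>h\<in>set_pmf q. pmf q h * (shannon (map_pmf (\<lambda>g. h \<circ> g) p)
      + (measure (map_pmf (\<lambda>g. h \<circ> g) p) {} - measure (p \<star> q) {})\<^sup>2 / 4))"
  proof (intro sum_mono mult_left_mono)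
    fix h assume "h \<in> set_pmf q"
    then have "inj_on (\<lambda>g. h \<circ> g) (set_pmf p)"
      using inj by (auto intro!: inj_onI dest: fun.inj_map[THEN injD])
    then show "shannon p \<le> shannon (map_pmf (\<lambda>g. h \<circ> g) p)
      + (measure (map_pmf (\<lambda>g. h \<circ> g) p) {} - measure (p \<star> q) {})\<^sup>2 / 4"
      by (simp add: shannon_map_inj)
  qed simp
  also have "\<dots> \<le> shannon (p \<star> q)"
    unfolding eq using fin by (intro shannon_bind_ge) auto
  finally show ?thesis .
qed

text \<open>Composing with an element of \<open>K\<close> is an injective self-map of the finite set
  \<open>K\<close>, hence a permutation of it, and fixes the uniform measure. This gives both
  idempotence and the absorption of single elements.\<close>

lemma uniform_conv:
  assumes K: "finite K" "K \<noteq> {}" and closed: "\<And>h k. h \<in> K \<Longrightarrow> k \<in> K \<Longrightarrow> h \<circ> k \<in> K"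
    and surj: "\<And>k. k \<in> K \<Longrightarrow> surj k"
    and p: "set_pmf p \<subseteq> K"
  shows "p \<star> pmf_of_set K = pmf_of_set K"
proof -
  have "map_pmf (\<lambda>h. h \<circ> k) (pmf_of_set K) = pmf_of_set K" if k: "k \<in> K" for k
  proof -
    have inj: "inj_on (\<lambda>h. h \<circ> k) K"
      using surj[OF k] by (auto intro!: inj_onI) (metis surj_def comp_apply ext)
    then have "(\<lambda>h. h \<circ> k) ` K = K"
      using closed k K by (intro endo_inj_surj) auto
    then show ?thesis using map_pmf_of_set_inj[OF inj] K by simp
  qed
  then have "p \<star> pmf_of_set K = bind_pmf p (\<lambda>_. pmf_of_set K)"
    unfolding conv_pmf_def using p by (intro bind_pmf_cong refl) auto
  then show ?thesis by simp
qed

section \<open>Cluster points and subadditive sequences\<close>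

text \<open>A cluster point in a product of compact intervals serves as a limit along an ultrafilter.\<close>

lemma bounded_cluster_function:
  fixes Q :: "nat \<Rightarrow> 'i \<Rightarrow> real"
  assumes "\<And>n i. 0 \<le> Q n i \<and> Q n i \<le> 1"
  shows "\<exists>\<mu>. (\<forall>i. 0 \<le> \<mu> i) \<and>
    (\<forall>\<phi> c. continuous_on UNIV \<phi> \<longrightarrow> (\<lambda>n. \<phi> (Q n)) \<longlonglongrightarrow> c \<longrightarrow> \<phi> \<mu> = (c :: real))"
proof -
  let ?K = "PiE (UNIV :: 'i set) (\<lambda>_. {0..1::real})"
  have "compactin (product_topology (\<lambda>_. euclidean) UNIV) ?K"
    by (subst compactin_PiE) auto
  then have "compact ?K" by (simp add: euclidean_product_topology)
  moreover have "eventually (\<lambda>x. x \<in> ?K) (filtermap Q sequentially)"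
    using assms by (simp add: eventually_filtermap PiE_iff)
  moreover have "filtermap Q sequentially \<noteq> bot" by (simp add: filtermap_bot_iff)
  \<comment> \<open>The nontrivial infimum refines both filters, so \<open>\<phi>\<close> has along
    it the limit \<open>\<phi> \<mu>\<close> by continuity and the limit \<open>c\<close> by
    assumption.\<close>
  ultimately obtain \<mu> where \<mu>: "\<mu> \<in> ?K" "inf (nhds \<mu>) (filtermap Q sequentially) \<noteq> bot"
    unfolding compact_filter by blast
  show ?thesis
  proof (intro exI[of _ \<mu>] conjI allI impI)
    show "0 \<le> \<mu> i" for i using \<mu>(1) by (simp add: PiE_iff)
    fix \<phi> :: "('i \<Rightarrow> real) \<Rightarrow> real" and c
    assume cont: "continuous_on UNIV \<phi>" and lim: "(\<lambda>n. \<phi> (Q n)) \<longlonglongrightarrow> c"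
    have "(\<phi> \<longlongrightarrow> \<phi> \<mu>) (at \<mu>)" using cont by (simp add: continuous_on_def)
    then have "(\<phi> \<longlongrightarrow> \<phi> \<mu>) (nhds \<mu>)"
      unfolding tendsto_at_iff_tendsto_nhds .
    then have "(\<phi> \<longlongrightarrow> \<phi> \<mu>) (inf (nhds \<mu>) (filtermap Q sequentially))"
      by (rule tendsto_mono[OF inf_le1])
    moreover have "(\<phi> \<longlongrightarrow> c) (filtermap Q sequentially)"
      using lim by (simp add: filterlim_def filtermap_filtermap)
    then have "(\<phi> \<longlongrightarrow> c) (inf (nhds \<mu>) (filtermap Q sequentially))"
      by (rule tendsto_mono[OF inf_le2])
    ultimately show "\<phi> \<mu> = c" by (rule tendsto_unique[OF \<mu>(2)])
  qed
qed

text \<open>Fekete's argument. The upper bound is a linear function valid for every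
  \<open>n\<close>, not an asymptotic statement, because it is later averaged over a random
  \<open>n\<close>.\<close>

lemma subadditive_linear_bound:
  fixes u :: "nat \<Rightarrow> real"
  assumes sub: "\<And>m n. u (m + n) \<le> u m + u n" and nonneg: "\<And>n. 0 \<le> u n"
  obtains h where "0 \<le> h" "\<And>n. h * real n \<le> u n"
    and "\<And>e. 0 < e \<Longrightarrow> \<exists>C\<ge>0. \<forall>n. u n \<le> (h + e) * real n + C"
proof
  \<comment> \<open>The index 0 is left out: \<open>u 0 / real 0\<close> is 0 and would force
    \<open>h = 0\<close>.\<close>
  define h where "h = (INF n\<in>{1..}. u n / real n)"
  have bdd: "bdd_below ((\<lambda>n. u n / real n) ` {1..})"
    using nonneg by (intro bdd_belowI[of _ 0]) auto
  show "0 \<le> h" unfolding h_def using nonneg by (intro cINF_greatest) auto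
  show "h * real n \<le> u n" for n
  proof (cases "n = 0")
    case False
    then have "h \<le> u n / real n" unfolding h_def by (intro cINF_lower bdd) auto
    then show ?thesis using False by (simp add: field_simps)
  qed (simp add: nonneg)
  fix e :: real assume "0 < e"
  then have "(INF n\<in>{1..}. u n / real n) < h + e" by (simp add: h_def)
  \<comment> \<open>Blocks of this length \<open>m\<close> are stripped off \<open>n\<close> one at
    a time; the sum of all \<open>u r\<close> with \<open>r < m\<close> dominates what
    remains.\<close>
  then obtain m where m: "1 \<le> m" "u m / real m < h + e"
    by (subst (asm) cINF_less_iff[OF _ bdd]) auto
  then have um: "u m \<le> (h + e) * real m" by (simp add: field_simps)
  have "u n \<le> (h + e) * real n + (\<Sum>r<m. u r)" for n
  proof (induction n rule: less_induct)
    case (less n)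
    show ?case
    proof (cases "n < m")
      case True
      then have "u n \<le> (\<Sum>r<m. u r)" using nonneg by (intro member_le_sum) auto
      moreover have "0 \<le> (h + e) * real n" using \<open>0 \<le> h\<close> \<open>0 < e\<close> by simp
      ultimately show ?thesis by linarith
    next
      case False
      then have "u n \<le> u m + u (n - m)" using sub[of m "n - m"] by simp
      also have "\<dots> \<le> (h + e) * real m + ((h + e) * real (n - m) + (\<Sum>r<m. u r))"
        using m(1) False by (intro add_mono um less) auto
      finally show ?thesis using False by (simp add: of_nat_diff algebra_simps)
    qed
  qed
  then show "\<exists>C\<ge>0. \<forall>n. u n \<le> (h + e) * real n + C"
    using nonneg by (intro exI[of _ "\<Sum>r<m. u r"]) (auto intro: sum_nonneg)
qed

text \<open>Increments of at least \<open>e\<close> throughout would give growth at rate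
  \<open>e\<close>, against the bound with slope \<open>e / 2\<close>.\<close>

lemma small_increment:
  fixes u :: "nat \<Rightarrow> real"
  assumes nonneg: "\<And>n. 0 \<le> u n"
    and bound: "\<And>e. 0 < e \<Longrightarrow> \<exists>C. \<forall>n. u n \<le> e * real n + C"
    and "0 < e"
  shows "\<exists>n. u (Suc n) - u n < e"
proof (rule ccontr)
  assume "\<not> ?thesis"
  then have inc: "e \<le> u (Suc n) - u n" for n by (simp add: not_less)
  have lower: "e * real n \<le> u n" for n
  proof (induction n)
    case (Suc n)
    then show ?case using inc[of n] by (simp add: algebra_simps)
  qed (simp add: nonneg)
  obtain C where C: "\<And>n. u n \<le> e / 2 * real n + C" using bound[of "e / 2"] \<open>0 < e\<close> by auto
  obtain n where "2 * C / e < real n" using reals_Archimedean2 by blast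
  then have "C < e / 2 * real n" using \<open>0 < e\<close> by (simp add: field_simps)
  then show False using lower[of n] C[of n] by (simp add: field_simps)
qed

section \<open>The alternating walk on the Mother group\<close>

definition unif_A :: "('x \<Rightarrow> 'x) pmf" where
  "unif_A = pmf_of_set (carrier mother_A)"

definition unif_B :: "'x \<Rightarrow> (('x \<Rightarrow> 'x \<Rightarrow> 'x) \<times> ('x \<Rightarrow> 'x)) pmf" where
  "unif_B x0 = pmf_of_set (carrier (mother_B x0))"

definition walk_A :: "('x list \<Rightarrow> 'x list) pmf" where
  "walk_A = map_pmf act_A unif_A"

definition walk_B :: "'x \<Rightarrow> ('x list \<Rightarrow> 'x list) pmf" where
  "walk_B x0 = map_pmf (act_B x0) (unif_B x0)"

lemma finite_mother_A: "finite (carrier (mother_A :: ('x :: finite \<Rightarrow> 'x) monoid))"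
  by simp

lemma sym_on_not_empty: "carrier (sym_on S) \<noteq> {}"
proof -
  have "id \<in> carrier (sym_on S)" by (simp add: sym_on_def permutes_id)
  then show ?thesis by blast
qed

lemma finite_mother_B: "finite (carrier (mother_B (x0 :: 'x :: finite)))"
  by (auto simp: mother_B_def intro!: finite_PiE)

lemma mother_B_not_empty: "carrier (mother_B x0) \<noteq> {}"
  using group.is_monoid[OF group_mother_B, of x0] monoid.one_closed by fast

lemma set_walk_A: "set_pmf (walk_A :: ('x :: finite list \<Rightarrow> _) pmf) = act_A ` carrier mother_A"
  by (simp add: walk_A_def unif_A_def set_pmf_of_set[OF sym_on_not_empty finite_mother_A])

lemma set_walk_B: "set_pmf (walk_B (x0 :: 'x :: finite)) = act_B x0 ` carrier (mother_B x0)"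
  by (simp add: walk_B_def unif_B_def set_pmf_of_set[OF mother_B_not_empty finite_mother_B])

lemma walk_A_conv:
  assumes "set_pmf p \<subseteq> act_A ` carrier mother_A"
  shows "p \<star> walk_A = (walk_A :: ('x :: finite list \<Rightarrow> 'x list) pmf)"
proof -
  have "walk_A = pmf_of_set (act_A ` carrier (mother_A :: ('x \<Rightarrow> 'x) monoid))"
    unfolding walk_A_def unif_A_def
    by (intro map_pmf_of_set_inj sym_on_not_empty finite_mother_A inj_on_subset[OF inj_act_A]) auto
  moreover have "p \<star> pmf_of_set (act_A ` carrier mother_A) = pmf_of_set (act_A ` carrier (mother_A :: ('x \<Rightarrow> 'x) monoid))"
  proof (rule uniform_conv)
    fix h k :: "'x list \<Rightarrow> 'x list" assume "h \<in> act_A ` carrier mother_A" "k \<in> act_A ` carrier mother_A"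
    then obtain a b where "a permutes UNIV" "b permutes UNIV" "h = act_A a" "k = act_A b"
      by (auto simp: sym_on_def)
    then show "h \<circ> k \<in> act_A ` carrier mother_A"
      by (intro image_eqI[of _ _ "a \<circ> b"]) (auto simp: sym_on_def act_A_comp permutes_compose)
  next
    fix k :: "'x list \<Rightarrow> 'x list" assume "k \<in> act_A ` carrier mother_A"
    then have "k \<in> carrier tree_aut" by (elim imageE) (simp only: act_A_in_tree_aut)
    then show "surj k" by (simp add: tree_aut_def bij_is_surj)
  qed (use assms sym_on_not_empty in auto)
  ultimately show ?thesis by simp
qed

lemma walk_B_conv:
  fixes x0 :: "'x :: finite"
  assumes "set_pmf p \<subseteq> act_B x0 ` carrier (mother_B x0)"
  shows "p \<star> walk_B x0 = walk_B x0"
proof -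
  have "walk_B x0 = pmf_of_set (act_B x0 ` carrier (mother_B x0))"
    unfolding walk_B_def unif_B_def
    by (intro map_pmf_of_set_inj mother_B_not_empty finite_mother_B inj_on_act_B)
  moreover have "p \<star> pmf_of_set (act_B x0 ` carrier (mother_B x0)) = pmf_of_set (act_B x0 ` carrier (mother_B x0))"
  proof (rule uniform_conv)
    fix h k assume "h \<in> act_B x0 ` carrier (mother_B x0)" "k \<in> act_B x0 ` carrier (mother_B x0)"
    then obtain a b where ab: "a \<in> carrier (mother_B x0)" "b \<in> carrier (mother_B x0)"
      "h = act_B x0 a" "k = act_B x0 b" by blast
    have "h \<circ> k = act_B x0 (b \<otimes>\<^bsub>mother_B x0\<^esub> a)"
      unfolding ab(3,4) by (rule ext) (simp only: act_B_mult[OF ab(2,1)] comp_apply)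
    then show "h \<circ> k \<in> act_B x0 ` carrier (mother_B x0)"
      by (rule image_eqI) (rule mother_B_mult_closed[OF ab(2,1)])
  next
    fix k assume "k \<in> act_B x0 ` carrier (mother_B x0)"
    then have "k \<in> carrier tree_aut" by (elim imageE) (simp only: act_B_in_tree_aut)
    then show "surj k" by (simp add: tree_aut_def bij_is_surj)
  qed (simp_all only: assms finite_mother_B mother_B_not_empty finite_imageI image_is_empty not_False_eq_True)
  ultimately show ?thesis by simp
qed

text \<open>The law of \<open>a z\<close> is invariant under every permutation of the letters, since
  \<open>a \<mapsto> t \<circ> a\<close> permutes the symmetric group. A transposition carries any
  letter to \<open>z\<close>, so all masses are equal.\<close>

lemma map_eval_unif_A: "map_pmf (\<lambda>a. a z) unif_A = pmf_of_set (UNIV :: 'x :: finite set)"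
proof -
  let ?p = "map_pmf (\<lambda>a. a z) unif_A :: 'x pmf"
  have inv: "map_pmf t ?p = ?p" if "t permutes UNIV" for t
  proof -
    have inj: "inj_on (\<lambda>a. t \<circ> a) (carrier mother_A)"
      using permutes_inj[OF that] by (auto intro!: inj_onI dest: fun.inj_map[THEN injD])
    then have "(\<lambda>a. t \<circ> a) ` carrier mother_A = carrier mother_A"
      using that by (intro endo_inj_surj finite_mother_A) (auto simp: sym_on_def permutes_compose)
    then have "map_pmf (\<lambda>a. t \<circ> a) unif_A = unif_A"
      unfolding unif_A_def using map_pmf_of_set_inj[OF inj sym_on_not_empty finite_mother_A] by simp
    then have "map_pmf (\<lambda>a. a z) (map_pmf (\<lambda>a. t \<circ> a) unif_A) = ?p" by simp
    then show ?thesis by (simp add: pmf.map_comp comp_def)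
  qed
  have const: "pmf ?p y = pmf ?p z" for y
  proof -
    let ?t = "Transposition.transpose y z"
    have "?t permutes UNIV" by (simp add: permutes_swap_id)
    then have "pmf (map_pmf ?t ?p) (?t y) = pmf ?p (?t y)" by (simp only: inv)
    moreover have "pmf (map_pmf ?t ?p) (?t y) = pmf ?p y" by (rule pmf_map_inj') simp
    ultimately show ?thesis by simp
  qed
  have "(\<Sum>y\<in>UNIV. pmf ?p y) = 1" by (intro sum_pmf_eq_1) auto
  moreover have "(\<Sum>y\<in>UNIV. pmf ?p y) = (\<Sum>y\<in>(UNIV :: 'x set). pmf ?p z)" by (rule sum.cong[OF refl const])
  ultimately have "real CARD('x) * pmf ?p z = 1" by simp
  then have z: "pmf ?p z = 1 / real CARD('x)" by (simp add: field_simps)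
  have "pmf ?p y = 1 / real CARD('x)" for y using const[of y] unfolding z .
  then show ?thesis by (intro pmf_eqI) simp
qed

lemma pmf_of_set_Times:
  assumes "finite A" "finite B" "A \<noteq> {}" "B \<noteq> {}"
  shows "pmf_of_set (A \<times> B) = pair_pmf (pmf_of_set A) (pmf_of_set B)"
proof (rule pmf_eqI)
  fix z
  show "pmf (pmf_of_set (A \<times> B)) z = pmf (pair_pmf (pmf_of_set A) (pmf_of_set B)) z"
    using assms by (cases z) (simp add: pmf_pair card_cartesian_product indicator_def)
qed

lemma map_component_unif_B:
  fixes x0 :: "'x :: finite"
  assumes "x \<noteq> x0"
  shows "map_pmf (\<lambda>b. fst b x) (unif_B x0) = unif_A"
proof -
  \<comment> \<open>With default value \<open>undefined\<close> both function spaces coincide, so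
    the uniform measure on them is a product measure \<open>Pi_pmf\<close> and has a uniform
    component at \<open>x\<close>.\<close>
  have PiE: "(- {x0} \<rightarrow>\<^sub>E carrier mother_A) = PiE_dflt (- {x0}) undefined (\<lambda>_. carrier (mother_A :: ('x \<Rightarrow> 'x) monoid))"
    by (auto simp: PiE_dflt_def PiE_iff extensional_def)
  have "unif_B x0 = pair_pmf (pmf_of_set (- {x0} \<rightarrow>\<^sub>E carrier mother_A)) (pmf_of_set (carrier (sym_on (- {x0}))))"
    unfolding unif_B_def
    by (subst pmf_of_set_Times[symmetric])
      (simp_all add: mother_B_def PiE_eq_empty_iff sym_on_not_empty finite_PiE)
  then have "map_pmf (\<lambda>b. fst b x) (unif_B x0)
      = map_pmf (\<lambda>f. f x) (map_pmf fst (pair_pmf (pmf_of_set (- {x0} \<rightarrow>\<^sub>E carrier mother_A)) (pmf_of_set (carrier (sym_on (- {x0}))))))"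
    by (simp add: pmf.map_comp comp_def)
  also have "\<dots> = map_pmf (\<lambda>f. f x) (Pi_pmf (- {x0}) undefined (\<lambda>_. unif_A))"
    unfolding map_fst_pair_pmf PiE unif_A_def
    by (subst Pi_pmf_of_set) (auto simp: sym_on_not_empty)
  also have "\<dots> = unif_A"
    using assms by (subst Pi_pmf_component) auto
  finally show ?thesis .
qed

text \<open>Both ends are \<open>walk_A\<close>, so the two factors that meet in a concatenation
  merge by idempotence and the numbers of factors \<open>walk_B\<close> add up. Subadditivity of the
  entropy rests on this.\<close>

fun walk :: "'x \<Rightarrow> nat \<Rightarrow> ('x list \<Rightarrow> 'x list) pmf" where
  "walk x0 0 = walk_A"
| "walk x0 (Suc n) = walk x0 n \<star> walk_B x0 \<star> walk_A"

lemma walk_add: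
  fixes x0 :: "'x :: finite"
  shows "walk x0 m \<star> walk x0 n = walk x0 (m + n)"
proof (induction n)
  case 0
  have AA: "walk_A \<star> walk_A = (walk_A :: ('x list \<Rightarrow> 'x list) pmf)"
    by (rule walk_A_conv) (simp add: set_walk_A)
  show ?case by (cases m) (simp_all add: AA conv_assoc)
qed (simp add: conv_assoc[symmetric])

text \<open>A factor \<open>walk_B\<close> is needed on the left of \<open>walk x0 n\<close>: the
  entropy gained there controls the left translates of \<open>walk x0 n\<close> by
  \<open>B\<close>.\<close>

lemma walk_Suc_left:
  fixes x0 :: "'x :: finite"
  shows "walk x0 (Suc n) = walk_A \<star> (walk_B x0 \<star> walk x0 n)"
proof (induction n)
  case (Suc n)
  have "walk x0 (Suc (Suc n)) = walk_A \<star> (walk_B x0 \<star> walk x0 n) \<star> walk_B x0 \<star> walk_A"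
    by (simp only: walk.simps(2)[of x0 "Suc n"] Suc)
  then show ?case by (simp only: conv_assoc walk.simps(2)[of x0 n])
qed (simp add: conv_assoc)

section \<open>Supports of the walks and subadditivity of their entropy\<close>

abbreviation mother_gens :: "'x \<Rightarrow> ('x list \<Rightarrow> 'x list) set" where
  "mother_gens x0 \<equiv> act_A ` carrier mother_A \<union> act_B x0 ` carrier (mother_B x0)"

lemma carrier_mother_group: "carrier (mother_group x0) = generate tree_aut (mother_gens x0)"
  by (simp add: mother_group_def)

lemma mother_group_mult: "g \<otimes>\<^bsub>mother_group x0\<^esub> h = h \<circ> g"
  by (simp add: mother_group_def tree_aut_def)

lemma mother_group_bij:
  assumes "g \<in> carrier (mother_group x0)"
  shows "bij g"
proof -
  have "mother_gens x0 \<subseteq> carrier tree_aut"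
    by (auto intro: act_A_in_tree_aut act_B_in_tree_aut)
  then have "g \<in> carrier tree_aut"
    using group.generate_in_carrier[OF group_tree_aut] assms unfolding carrier_mother_group by blast
  then show ?thesis by (simp add: tree_aut_def)
qed

lemma set_conv_mother:
  assumes "set_pmf p \<subseteq> carrier (mother_group x0)" "set_pmf q \<subseteq> carrier (mother_group x0)"
  shows "set_pmf (p \<star> q) \<subseteq> carrier (mother_group x0)"
proof -
  interpret group "mother_group x0" by (rule group_mother_group)
  show ?thesis
  proof
    fix f assume "f \<in> set_pmf (p \<star> q)"
    then obtain g h where gh: "g \<in> set_pmf p" "h \<in> set_pmf q" "f = h \<circ> g" by (auto simp: set_conv)
    then have "g \<otimes>\<^bsub>mother_group x0\<^esub> h \<in> carrier (mother_group x0)"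
      by (intro m_closed subsetD[OF assms(1)] subsetD[OF assms(2)])
    then show "f \<in> carrier (mother_group x0)" by (simp add: mother_group_mult gh(3))
  qed
qed

lemma set_walk_A_mother: "set_pmf (walk_A :: ('x :: finite list \<Rightarrow> _) pmf) \<subseteq> carrier (mother_group x0)"
  by (auto simp: set_walk_A carrier_mother_group intro: generate.incl)

lemma set_walk_B_mother: "set_pmf (walk_B (x0 :: 'x :: finite)) \<subseteq> carrier (mother_group x0)"
  by (auto simp: set_walk_B carrier_mother_group intro: generate.incl)

lemma set_walk_mother: "set_pmf (walk (x0 :: 'x :: finite) n) \<subseteq> carrier (mother_group x0)"
  by (induction n) (simp_all add: set_conv_mother set_walk_A_mother set_walk_B_mother)

lemma finite_walk_A: "finite (set_pmf (walk_A :: ('x :: finite list \<Rightarrow> _) pmf))"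
  by (simp add: set_walk_A)

lemma finite_walk_B: "finite (set_pmf (walk_B (x0 :: 'x :: finite)))"
  by (simp add: set_walk_B finite_mother_B)

lemma finite_walk: "finite (set_pmf (walk (x0 :: 'x :: finite) n))"
  by (induction n) (simp_all add: finite_set_conv finite_walk_A finite_walk_B)

definition walk_entropy :: "'x \<Rightarrow> nat \<Rightarrow> real" where
  "walk_entropy x0 n = shannon (walk x0 n)"

lemma walk_entropy_add:
  "walk_entropy (x0 :: 'x :: finite) (m + n) \<le> walk_entropy x0 m + walk_entropy x0 n"
  unfolding walk_entropy_def walk_add[symmetric]
  by (intro shannon_conv_le finite_walk) (rule bij_is_surj, rule mother_group_bij, erule subsetD[OF set_walk_mother])

section \<open>Sections of the walk\<close>

definition lazy_step :: "'x \<Rightarrow> ('x :: finite list \<Rightarrow> 'x list) pmf" where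
  "lazy_step x0 = bind_pmf (pmf_of_set UNIV) (\<lambda>y. if y = x0 then walk_B x0 else walk_A)"

fun lazy_walk :: "'x \<Rightarrow> nat \<Rightarrow> ('x :: finite list \<Rightarrow> 'x list) pmf" where
  "lazy_walk x0 0 = return_pmf id"
| "lazy_walk x0 (Suc n) = lazy_walk x0 n \<star> lazy_step x0"

lemma finite_lazy_step: "finite (set_pmf (lazy_step x0))"
  by (auto simp: lazy_step_def finite_walk_A finite_walk_B)

lemma finite_lazy_walk: "finite (set_pmf (lazy_walk x0 n))"
  by (induction n) (simp_all add: finite_set_conv finite_lazy_step)

text \<open>The wreath recursion \<open>g = (g\<^sub>x)\<^sub>x \<sigma>\<close>: the pair \<open>(\<sigma> x, g\<^sub>x)\<close>.\<close>

definition wreath_coord :: "'x \<Rightarrow> ('x list \<Rightarrow> 'x list) \<Rightarrow> 'x \<times> ('x list \<Rightarrow> 'x list)" where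
  "wreath_coord x g = (hd (g [x]), \<lambda>w. tl (g (x # w)))"

text \<open>On other maps \<open>hd\<close> and \<open>tl\<close> lose information; under this
  condition the coordinates at all letters determine \<open>g\<close>.\<close>

definition has_wreath_recursion :: "('x list \<Rightarrow> 'x list) \<Rightarrow> bool" where
  "has_wreath_recursion g \<longleftrightarrow> g [] = [] \<and>
    (\<forall>x w. g (x # w) = fst (wreath_coord x g) # snd (wreath_coord x g) w)"

lemma has_wreath_recursionI:
  assumes "g [] = []" "\<And>x w. g (x # w) = f x # h x w"
  shows "has_wreath_recursion g"
  using assms by (simp add: has_wreath_recursion_def wreath_coord_def)

lemma has_wreath_recursion_comp:
  assumes "has_wreath_recursion g" "has_wreath_recursion h"
  shows "has_wreath_recursion (h \<circ> g)"
proof (rule has_wreath_recursionI)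
  show "(h \<circ> g) [] = []" using assms by (simp add: has_wreath_recursion_def)
  show "(h \<circ> g) (x # w) = fst (wreath_coord (fst (wreath_coord x g)) h)
      # snd (wreath_coord (fst (wreath_coord x g)) h) (snd (wreath_coord x g) w)" for x w
    using assms unfolding has_wreath_recursion_def by (metis comp_apply)
qed

lemma has_wreath_recursion_act_A: "has_wreath_recursion (act_A a)"
  by (rule has_wreath_recursionI) auto

lemma has_wreath_recursion_act_B: "has_wreath_recursion (act_B x0 b)"
  by (rule has_wreath_recursionI[where f = "\<lambda>x. if x = x0 then x0 else snd b x"
        and h = "\<lambda>x. if x = x0 then act_B x0 b else act_A (fst b x)"]) auto

lemma has_wreath_recursion_conv:
  assumes "\<And>g. g \<in> set_pmf p \<Longrightarrow> has_wreath_recursion g" "\<And>g. g \<in> set_pmf q \<Longrightarrow> has_wreath_recursion g"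
    and "g \<in> set_pmf (p \<star> q)"
  shows "has_wreath_recursion g"
  using assms has_wreath_recursion_comp by (auto simp: set_conv)

lemma has_wreath_recursion_walk: "g \<in> set_pmf (walk (x0 :: 'x :: finite) n) \<Longrightarrow> has_wreath_recursion g"
proof (induction n arbitrary: g)
  case 0
  then show ?case by (auto simp: set_walk_A has_wreath_recursion_act_A)
next
  case (Suc n)
  have A: "has_wreath_recursion g" if "g \<in> set_pmf walk_A" for g :: "'x list \<Rightarrow> _"
    using that by (auto simp: set_walk_A has_wreath_recursion_act_A)
  have B: "has_wreath_recursion g" if "g \<in> set_pmf (walk_B x0)" for g
    using that by (auto simp: set_walk_B has_wreath_recursion_act_B)
  show ?case
    using Suc.prems
    by (auto intro: has_wreath_recursion_conv[OF has_wreath_recursion_conv[OF Suc.IH B] A])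
qed

definition sect_B :: "'x \<Rightarrow> ('x \<Rightarrow> 'x \<Rightarrow> 'x) \<times> ('x \<Rightarrow> 'x) \<Rightarrow> 'x \<Rightarrow> 'x list \<Rightarrow> 'x list" where
  "sect_B x0 b y = (if y = x0 then act_B x0 b else act_A (fst b y))"

text \<open>\<open>act_A a\<close> changes the first letter only, so the section grows just by the
  section of \<open>b\<close> at \<open>y\<close>, the letter to which \<open>g\<close> sends
  \<open>x\<close>.\<close>

lemma wreath_coord_act:
  assumes "has_wreath_recursion g"
  shows "wreath_coord x (act_A a \<circ> (act_B x0 b \<circ> g)) =
    (let (y, s) = wreath_coord x g
     in (a (if y = x0 then x0 else snd b y), sect_B x0 b y \<circ> s))"
proof -
  obtain y s where ys: "wreath_coord x g = (y, s)" by (cases "wreath_coord x g")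
  have "g (x # w) = y # s w" for w
    using assms ys by (simp add: has_wreath_recursion_def)
  then show ?thesis unfolding ys by (auto simp: wreath_coord_def sect_B_def fun_eq_iff)
qed

lemma map_sect_unif_B:
  fixes x0 :: "'x :: finite"
  shows "map_pmf (\<lambda>b. sect_B x0 b y) (unif_B x0) = (if y = x0 then walk_B x0 else walk_A)"
proof (cases "y = x0")
  case False
  then show ?thesis
    using pmf.map_comp[of act_A "\<lambda>b. fst b y" "unif_B x0"]
    by (simp add: sect_B_def walk_A_def map_component_unif_B comp_def)
qed (simp add: sect_B_def walk_B_def)

lemma pair_pmf_flip: "pair_pmf p q = bind_pmf q (\<lambda>k. map_pmf (\<lambda>c. (c, k)) p)"
  unfolding pair_pmf_def map_pmf_def by (rule bind_commute_pmf)

text \<open>A factor of the walk acts on the wreath coordinate at a uniform letter, hence contributes an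
  element of \<open>B\<close> to the section exactly if that letter is \<open>x0\<close>, and the following
  element of \<open>A\<close> makes the letter uniform again.\<close>

lemma map_wreath_coord_walk:
  fixes x0 :: "'x :: finite"
  shows "map_pmf (wreath_coord x) (walk x0 n) = pair_pmf (pmf_of_set UNIV) (lazy_walk x0 n)"
proof (induction n)
  case 0
  have "map_pmf (wreath_coord x) walk_A = map_pmf (\<lambda>c. (c, id)) (map_pmf (\<lambda>a. a x) unif_A)"
    unfolding walk_A_def pmf.map_comp by (intro map_pmf_cong refl) (simp add: wreath_coord_def id_def)
  then show ?case by (simp add: map_eval_unif_A pair_return_pmf2)
next
  case (Suc n)
  let ?u = "pmf_of_set (UNIV :: 'x set)"
  define G :: "'x \<times> ('x list \<Rightarrow> 'x list) \<Rightarrow> _" where "G = (\<lambda>(y, s). bind_pmf (unif_B x0) (\<lambda>b. map_pmf (\<lambda>c. (c, sect_B x0 b y \<circ> s)) ?u))"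
  have "map_pmf (wreath_coord x) (walk x0 (Suc n)) = bind_pmf (walk x0 n)
      (\<lambda>g. bind_pmf (unif_B x0) (\<lambda>b. map_pmf (\<lambda>a. wreath_coord x (act_A a \<circ> (act_B x0 b \<circ> g))) unif_A))"
    by (simp add: conv_pmf_def walk_A_def walk_B_def map_bind_pmf bind_map_pmf bind_assoc_pmf
        pmf.map_comp comp_def)
  also have "\<dots> = bind_pmf (walk x0 n) (\<lambda>g. G (wreath_coord x g))"
  proof (rule bind_pmf_cong[OF refl])
    fix g assume "g \<in> set_pmf (walk x0 n)"
    then have g: "has_wreath_recursion g" by (rule has_wreath_recursion_walk)
    obtain y s where ys: "wreath_coord x g = (y, s)" by (cases "wreath_coord x g")
    have "map_pmf (\<lambda>a. wreath_coord x (act_A a \<circ> (act_B x0 b \<circ> g))) unif_A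
        = map_pmf (\<lambda>c. (c, sect_B x0 b y \<circ> s)) ?u" for b
    proof -
      have "map_pmf (\<lambda>a. wreath_coord x (act_A a \<circ> (act_B x0 b \<circ> g))) unif_A
          = map_pmf (\<lambda>c. (c, sect_B x0 b y \<circ> s)) (map_pmf (\<lambda>a. a (if y = x0 then x0 else snd b y)) unif_A)"
        unfolding pmf.map_comp by (intro map_pmf_cong refl) (simp add: wreath_coord_act[OF g] ys)
      then show ?thesis by (simp only: map_eval_unif_A)
    qed
    then show "bind_pmf (unif_B x0) (\<lambda>b. map_pmf (\<lambda>a. wreath_coord x (act_A a \<circ> (act_B x0 b \<circ> g))) unif_A)
        = G (wreath_coord x g)"
      by (simp only: G_def ys prod.case)
  qed
  also have "\<dots> = bind_pmf (map_pmf (wreath_coord x) (walk x0 n)) G"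
    by (simp add: bind_map_pmf)
  also have "\<dots> = bind_pmf ?u (\<lambda>y. bind_pmf (lazy_walk x0 n) (\<lambda>s. G (y, s)))"
    by (simp add: Suc.IH pair_pmf_def bind_assoc_pmf bind_return_pmf)
  \<comment> \<open>Letter and section are independent by induction, so the letter may be drawn
    after the section, where it becomes the random choice in \<open>lazy_step\<close>. The new
    letter \<open>c\<close> is again uniform and independent.\<close>
  also have "\<dots> = bind_pmf (lazy_walk x0 n) (\<lambda>s. bind_pmf ?u (\<lambda>y. G (y, s)))"
    by (rule bind_commute_pmf)
  also have "\<dots> = pair_pmf ?u (lazy_walk x0 (Suc n))"
    by (simp add: pair_pmf_flip lazy_step_def conv_pmf_def bind_assoc_pmf map_bind_pmf bind_map_pmf
        map_sect_unif_B[symmetric] G_def comp_def)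
  finally show ?case .
qed

lemma shannon_pair_le:
  assumes "finite (set_pmf p)" "finite (set_pmf q)"
  shows "shannon (pair_pmf p q) \<le> shannon p + shannon q"
proof -
  have eq: "pair_pmf p q = bind_pmf p (\<lambda>x. map_pmf (Pair x) q)"
    by (simp add: pair_pmf_def map_pmf_def)
  have "shannon (pair_pmf p q) \<le> shannon p + (\<Sum>x\<in>set_pmf p. pmf p x * shannon (map_pmf (Pair x) q))"
    unfolding eq using assms by (intro shannon_bind_le) auto
  also have "\<dots> = shannon p + shannon q"
    using sum_pmf_const[OF assms(1)] by (simp add: shannon_map_inj inj_on_def)
  finally show ?thesis .
qed

text \<open>An element of the walk is determined by its wreath coordinates. Each of them consists of
  a letter, of entropy at most \<open>ln\<close> of the alphabet size, and a section distributed as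
  the lazy walk.\<close>

lemma walk_entropy_le_lazy:
  fixes x0 :: "'x :: finite"
  shows "walk_entropy x0 n \<le> real CARD('x) * (ln (real CARD('x)) + shannon (lazy_walk x0 n))"
proof -
  have "walk_entropy x0 n \<le> (\<Sum>x\<in>UNIV. shannon (map_pmf (wreath_coord x) (walk x0 n)))"
    unfolding walk_entropy_def
  proof (rule shannon_le_sum_coordinates[OF finite finite_walk])
    fix g h assume "g \<in> set_pmf (walk x0 n)" "h \<in> set_pmf (walk x0 n)"
      and eq: "\<And>x. x \<in> UNIV \<Longrightarrow> wreath_coord x g = wreath_coord x h"
    then have "has_wreath_recursion g" "has_wreath_recursion h" by (auto intro: has_wreath_recursion_walk)
    then have "g w = h w" for w
      using eq by (cases w) (auto simp: has_wreath_recursion_def)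
    then show "g = h" by (rule ext)
  qed
  also have "\<dots> \<le> (\<Sum>x\<in>(UNIV :: 'x set). ln (real CARD('x)) + shannon (lazy_walk x0 n))"
  proof (rule sum_mono)
    fix x
    have "shannon (pmf_of_set (UNIV :: 'x set)) \<le> ln (real CARD('x))"
      by (intro shannon_le_ln_card) auto
    then show "shannon (map_pmf (wreath_coord x) (walk x0 n)) \<le> ln (real CARD('x)) + shannon (lazy_walk x0 n)"
      using shannon_pair_le[of "pmf_of_set (UNIV :: 'x set)" "lazy_walk x0 n"]
      by (simp add: map_wreath_coord_walk finite_lazy_walk)
  qed
  finally show ?thesis by simp
qed

section \<open>The lazy walk as a mixture of shorter alternating walks\<close>

text \<open>Since \<open>walk_A\<close> and \<open>walk_B\<close> are idempotent, only the number of blocks of equal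
  letters in a product of \<open>walk_A\<close> and \<open>walk_B\<close> matters. The state \<open>(k, l)\<close> stands for
  \<open>walk x0 k\<close>, followed by an unfinished block of \<open>B\<close> if \<open>l\<close>.\<close>

definition block_step :: "'x \<Rightarrow> nat \<times> bool \<Rightarrow> 'x \<Rightarrow> nat \<times> bool" where
  "block_step x0 s y = (if y = x0 then (fst s, True) else (if snd s then Suc (fst s) else fst s, False))"

fun blocks :: "'x :: finite \<Rightarrow> nat \<Rightarrow> (nat \<times> bool) pmf" where
  "blocks x0 0 = return_pmf (0, False)"
| "blocks x0 (Suc n) = bind_pmf (blocks x0 n) (\<lambda>s. map_pmf (block_step x0 s) (pmf_of_set UNIV))"

definition block_law :: "'x \<Rightarrow> nat \<times> bool \<Rightarrow> ('x list \<Rightarrow> 'x list) pmf" where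
  "block_law x0 s = (if snd s then walk x0 (fst s) \<star> walk_B x0 else walk x0 (fst s))"

lemma walk_idem:
  fixes x0 :: "'x :: finite"
  shows "walk x0 k \<star> walk_A = walk x0 k" "walk_A \<star> walk x0 k = walk x0 k"
    "walk_B x0 \<star> walk_B x0 = walk_B x0"
  using walk_add[of x0 k 0] walk_add[of x0 0 k] walk_B_conv[of "walk_B x0" x0] by (simp_all add: set_walk_B)

lemma block_law_step:
  fixes x0 :: "'x :: finite"
  shows "block_law x0 s \<star> (if y = x0 then walk_B x0 else walk_A) = block_law x0 (block_step x0 s y)"
  by (auto simp: block_law_def block_step_def walk_idem conv_assoc[of _ "walk_B x0" "walk_B x0"])

text \<open>The leading \<open>walk_A\<close> absorbs initial factors \<open>walk_A\<close>, so
  every product starts from the state \<open>(0, False)\<close>, whose law is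
  \<open>walk x0 0\<close>.\<close>

lemma walk_A_conv_lazy_walk: "walk_A \<star> lazy_walk x0 n = bind_pmf (blocks x0 n) (block_law x0)"
proof (induction n)
  case 0
  show ?case by (simp add: conv_return_right bind_return_pmf block_law_def)
next
  case (Suc n)
  have "walk_A \<star> lazy_walk x0 (Suc n) = bind_pmf (blocks x0 n) (\<lambda>s. block_law x0 s \<star> lazy_step x0)"
    by (simp add: conv_assoc[symmetric] Suc conv_bind_left)
  then show ?case
    by (simp add: lazy_step_def conv_bind_right block_law_step bind_assoc_pmf bind_map_pmf)
qed

lemma set_blocks: "set_pmf (blocks x0 n) \<subseteq> {..n} \<times> UNIV"
  by (induction n) (fastforce simp: block_step_def split: if_splits)+

lemma finite_blocks: "finite (set_pmf (blocks x0 n))"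
  using set_blocks by (rule finite_subset) simp

lemma sum_blocks_Suc:
  fixes x0 :: "'x :: finite" and F :: "nat \<times> bool \<Rightarrow> real"
  shows "(\<Sum>s\<in>set_pmf (blocks x0 (Suc n)). pmf (blocks x0 (Suc n)) s * F s)
    = (\<Sum>s\<in>set_pmf (blocks x0 n). pmf (blocks x0 n) s * ((\<Sum>y\<in>UNIV. F (block_step x0 s y)) / real CARD('x)))"
proof -
  have "(\<Sum>s\<in>set_pmf (blocks x0 (Suc n)). pmf (blocks x0 (Suc n)) s * F s)
      = measure_pmf.expectation (blocks x0 (Suc n)) F"
    by (rule expectation_finite[OF finite_blocks, symmetric])
  also have "\<dots> = (\<Sum>s\<in>set_pmf (blocks x0 n). pmf (blocks x0 n) s *\<^sub>R
      measure_pmf.expectation (map_pmf (block_step x0 s) (pmf_of_set UNIV)) F)"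
    unfolding blocks.simps by (intro pmf_expectation_bind finite_blocks) auto
  finally show ?thesis by (simp add: integral_pmf_of_set)
qed

text \<open>The count grows exactly when an unfinished block of \<open>B\<close> meets a letter
  other than \<open>x0\<close>. The flag is set with probability \<open>1 / d\<close> after a step
  and 0 at the start; the next letter is independent of it and differs from \<open>x0\<close> with
  probability \<open>1 - 1 / d\<close>.\<close>

lemma expected_blocks:
  fixes x0 :: "'x :: finite"
  defines "d \<equiv> real CARD('x)"
  shows "(\<Sum>s\<in>set_pmf (blocks x0 n). pmf (blocks x0 n) s * of_bool (snd s)) \<le> 1 / d"
    and "(\<Sum>s\<in>set_pmf (blocks x0 n). pmf (blocks x0 n) s * real (fst s)) \<le> real n * ((1 - 1 / d) / d)"
proof -
  have d: "1 \<le> d" by (simp add: d_def Suc_leI)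
  have card: "real (CARD('x) - Suc 0) = d - 1" by (simp add: d_def of_nat_diff Suc_leI)
  show l: "(\<Sum>s\<in>set_pmf (blocks x0 n). pmf (blocks x0 n) s * of_bool (snd s)) \<le> 1 / d" for n
  proof (cases n)
    case (Suc m)
    have "(\<Sum>y\<in>UNIV. of_bool (snd (block_step x0 s y))) = (\<Sum>y\<in>UNIV. if y = x0 then 1 else 0 :: real)" for s
      by (intro sum.cong refl) (simp add: block_step_def)
    then have "(\<Sum>s\<in>set_pmf (blocks x0 n). pmf (blocks x0 n) s * of_bool (snd s)) = 1 / d"
      unfolding Suc sum_blocks_Suc d_def
      using sum_pmf_const[OF finite_blocks, of x0 m "1 / real CARD('x)"] by simp
    then show ?thesis by simp
  qed (use d in simp)
  show "(\<Sum>s\<in>set_pmf (blocks x0 n). pmf (blocks x0 n) s * real (fst s)) \<le> real n * ((1 - 1 / d) / d)"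
  proof (induction n)
    case (Suc n)
    have "(\<Sum>y\<in>UNIV. real (fst (block_step x0 s y))) / d = real (fst s) + (1 - 1 / d) * of_bool (snd s)" for s
    proof -
      have "(\<Sum>y\<in>UNIV. real (fst (block_step x0 s y)))
          = real (fst s) + (\<Sum>y\<in>UNIV - {x0}. real (fst s) + of_bool (snd s))"
        by (subst sum.remove[of _ x0]) (auto simp: block_step_def intro!: sum.cong)
      also have "\<dots> = d * (real (fst s) + (1 - 1 / d) * of_bool (snd s))"
        using d by (simp add: card_Diff_singleton card field_simps)
      finally show ?thesis using d by simp
    qed
    then have "(\<Sum>s\<in>set_pmf (blocks x0 (Suc n)). pmf (blocks x0 (Suc n)) s * real (fst s))
        = (\<Sum>s\<in>set_pmf (blocks x0 n). pmf (blocks x0 n) s * (real (fst s) + (1 - 1 / d) * of_bool (snd s)))"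
      unfolding sum_blocks_Suc d_def by simp
    also have "\<dots> = (\<Sum>s\<in>set_pmf (blocks x0 n). pmf (blocks x0 n) s * real (fst s))
        + (1 - 1 / d) * (\<Sum>s\<in>set_pmf (blocks x0 n). pmf (blocks x0 n) s * of_bool (snd s))"
      by (simp only: distrib_left sum.distrib sum_distrib_left mult.left_commute)
    also have "\<dots> \<le> real n * ((1 - 1 / d) / d) + (1 - 1 / d) * (1 / d)"
      using d by (intro add_mono Suc mult_left_mono l) auto
    also have "\<dots> = real (Suc n) * ((1 - 1 / d) / d)" by (simp add: distrib_right add_divide_distrib)
    finally show ?case .
  qed simp
qed

lemma surj_mother: "set_pmf p \<subseteq> carrier (mother_group x0) \<Longrightarrow> g \<in> set_pmf p \<Longrightarrow> surj g"
  by (rule bij_is_surj, rule mother_group_bij, erule subsetD)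

lemma inj_mother: "set_pmf p \<subseteq> carrier (mother_group x0) \<Longrightarrow> g \<in> set_pmf p \<Longrightarrow> inj g"
  by (rule bij_is_inj, rule mother_group_bij, erule subsetD)

text \<open>Completing the law on the right by \<open>walk_A\<close>, or by \<open>walk_B\<close>
  and \<open>walk_A\<close>, gives \<open>walk x0 (Suc (fst s))\<close>, and multiplying on the
  right by bijections never lowers the entropy.\<close>

lemma shannon_block_law_le:
  fixes x0 :: "'x :: finite"
  shows "shannon (block_law x0 s) \<le> walk_entropy x0 (Suc (fst s))"
proof (cases "snd s")
  case True
  then show ?thesis
    unfolding block_law_def walk_entropy_def
    by (auto intro!: shannon_conv_ge_left finite_set_conv finite_walk finite_walk_A finite_walk_B
        inj_mother[OF set_walk_A_mother])
next
  case False
  have "shannon (walk x0 (fst s)) \<le> shannon (walk x0 (fst s) \<star> (walk_B x0 \<star> walk_A))"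
    by (intro shannon_conv_ge_left finite_set_conv finite_walk finite_walk_A finite_walk_B)
      (erule inj_mother[OF set_conv_mother[OF set_walk_B_mother set_walk_A_mother]])
  then show ?thesis using False by (simp add: block_law_def walk_entropy_def conv_assoc)
qed

lemma finite_block_law: "finite (set_pmf (block_law (x0 :: 'x :: finite) s))"
  by (simp add: block_law_def finite_set_conv finite_walk finite_walk_B)

text \<open>The entropy of the mixture is at most that of the block state plus a mean of block
  entropies. The state takes at most \<open>2 * Suc n\<close> values, which costs a logarithm; as
  the bound on \<open>walk_entropy\<close> is affine in \<open>k\<close>, only the expected block
  count enters.\<close>

lemma shannon_lazy_walk_le:
  fixes x0 :: "'x :: finite"
  assumes "0 \<le> a" and bound: "\<And>k. walk_entropy x0 k \<le> a * real k + C"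
  shows "shannon (lazy_walk x0 n) \<le> ln (2 * real (Suc n))
    + a * (real n * ((1 - 1 / real CARD('x)) / real CARD('x))) + a + C"
proof -
  let ?P = "blocks x0 n"
  have "shannon (lazy_walk x0 n) \<le> shannon (walk_A \<star> lazy_walk x0 n)"
    by (intro shannon_conv_ge_right finite_walk_A finite_lazy_walk) (erule surj_mother[OF set_walk_A_mother])
  also have "\<dots> \<le> shannon ?P + (\<Sum>s\<in>set_pmf ?P. pmf ?P s * shannon (block_law x0 s))"
    unfolding walk_A_conv_lazy_walk by (intro shannon_bind_le finite_blocks finite_block_law)
  also have "shannon ?P \<le> ln (real (card ({..n} \<times> (UNIV :: bool set))))"
    by (intro shannon_le_ln_card set_blocks) auto
  also have "card ({..n} \<times> (UNIV :: bool set)) = 2 * Suc n" by (simp add: card_cartesian_product)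
  also have "(\<Sum>s\<in>set_pmf ?P. pmf ?P s * shannon (block_law x0 s))
      \<le> (\<Sum>s\<in>set_pmf ?P. a * (pmf ?P s * real (fst s)) + pmf ?P s * (a + C))"
  proof (rule sum_mono)
    fix s
    have "shannon (block_law x0 s) \<le> a * real (fst s) + (a + C)"
      using shannon_block_law_le[of x0 s] bound[of "Suc (fst s)"] by (simp add: algebra_simps)
    then have "pmf ?P s * shannon (block_law x0 s) \<le> pmf ?P s * (a * real (fst s) + (a + C))"
      by (intro mult_left_mono) auto
    then show "pmf ?P s * shannon (block_law x0 s) \<le> a * (pmf ?P s * real (fst s)) + pmf ?P s * (a + C)"
      by (simp add: algebra_simps)
  qed
  also have "\<dots> = a * (\<Sum>s\<in>set_pmf ?P. pmf ?P s * real (fst s)) + (a + C)"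
    using sum_pmf_const[OF finite_blocks, of x0 n "a + C"] by (simp only: sum.distrib sum_distrib_left)
  also have "\<dots> \<le> a * (real n * ((1 - 1 / real CARD('x)) / real CARD('x))) + (a + C)"
    using assms(1) by (intro add_mono mult_left_mono expected_blocks(2)) auto
  finally show ?thesis by simp
qed

section \<open>Entropy growth and almost invariance\<close>

lemma walk_entropy_nonneg: "0 \<le> walk_entropy x0 n"
  by (simp add: walk_entropy_def shannon_nonneg)

lemma linear_not_le_log:
  fixes c :: real
  assumes "0 < c"
  shows "\<exists>n. K + d * ln (2 * real (Suc n)) < c * real n"
proof -
  have "(\<lambda>N. (K + c) / real N + d * (ln (real N) / real N)) \<longlonglongrightarrow> 0 + d * 0"
    by (intro tendsto_add tendsto_mult tendsto_const lim_ln_over_n lim_const_over_n)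
  then have "\<forall>\<^sub>F N in sequentially. (K + c) / real N + d * (ln (real N) / real N) < c / 2"
    using assms by (intro order_tendstoD(2)) auto
  then obtain N where N: "\<And>M. M \<ge> N \<Longrightarrow> (K + c) / real M + d * (ln (real M) / real M) < c / 2"
    by (auto simp: eventually_sequentially)
  \<comment> \<open>This turns \<open>ln (2 * real (Suc N))\<close> into \<open>ln (real M)\<close>.
    Since \<open>c / 2 * real M = c * real N + c\<close>, the constant was taken as
    \<open>K + c\<close> beforehand.\<close>
  define M where "M = 2 * Suc N"
  have M: "real M = 2 * real (Suc N)" "0 < real M" by (simp_all add: M_def)
  have "(K + c) / real M + d * (ln (real M) / real M) < c / 2" by (intro N) (simp add: M_def)
  then have "((K + c) / real M + d * (ln (real M) / real M)) * real M < c / 2 * real M"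
    using M(2) by (intro mult_strict_right_mono)
  moreover have "((K + c) / real M + d * (ln (real M) / real M)) * real M = K + c + d * ln (real M)"
    using M(2) by (simp add: field_simps)
  ultimately have "K + c + d * ln (real M) < c / 2 * real M" by simp
  moreover have "c / 2 * real M = c * real N + c" by (simp add: M(1) distrib_left)
  ultimately have "K + d * ln (real M) < c * real N" by linarith
  then show ?thesis unfolding M(1) by blast
qed

lemma walk_entropy_sublinear:
  fixes x0 :: "'x :: finite"
  assumes "0 < e"
  shows "\<exists>C. \<forall>n. walk_entropy x0 n \<le> e * real n + C"
proof -
  define d where "d = real CARD('x)"
  have d: "1 \<le> d" by (simp add: d_def Suc_leI)
  obtain h where h: "0 \<le> h" "\<And>n. h * real n \<le> walk_entropy x0 n"
    and ub: "\<And>e. 0 < e \<Longrightarrow> \<exists>C\<ge>0. \<forall>n. walk_entropy x0 n \<le> (h + e) * real n + C"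
    using subadditive_linear_bound[of "walk_entropy x0"] walk_entropy_add walk_entropy_nonneg by metis
  have "h = 0"
  proof (rule ccontr)
    assume "h \<noteq> 0"
    then have "0 < h" using h(1) by simp
    \<comment> \<open>A slope just above \<open>h\<close> for which
      \<open>a * (1 - 1 / d) = h - h / d\<^sup>2\<close> is still below \<open>h\<close>; the
      deficit is linear in \<open>n\<close> and beats the logarithm.\<close>
    define a where "a = h + h / d"
    have "0 < h / d" using \<open>0 < h\<close> d by simp
    then obtain C where C: "\<And>k. walk_entropy x0 k \<le> a * real k + C"
      using ub[of "h / d"] by (auto simp: a_def)
    have a: "0 \<le> a" using \<open>0 < h\<close> \<open>0 < h / d\<close> by (simp add: a_def)
    have le: "h * real n \<le> d * (ln d + (ln (2 * real (Suc n)) + a * (real n * ((1 - 1 / d) / d)) + a + C))" for n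
    proof -
      have "h * real n \<le> walk_entropy x0 n" by (rule h)
      also have "\<dots> \<le> d * (ln d + shannon (lazy_walk x0 n))"
        unfolding d_def by (rule walk_entropy_le_lazy)
      also have "\<dots> \<le> d * (ln d + (ln (2 * real (Suc n)) + a * (real n * ((1 - 1 / d) / d)) + a + C))"
        using d shannon_lazy_walk_le[OF a C, of n] unfolding d_def[symmetric]
        by (intro mult_left_mono add_mono) auto
      finally show ?thesis .
    qed
    have "a * (1 - 1 / d) = h - h / d\<^sup>2"
      using d by (simp add: a_def field_simps power2_eq_square)
    \<comment> \<open>The factor \<open>d\<close> for the number of sections cancels the divisor
      \<open>d\<close> in the mean block count, and the contraction \<open>1 - 1 / d\<close>
      remains.\<close>
    moreover have "d * (a * (real n * ((1 - 1 / d) / d))) = a * (1 - 1 / d) * real n" for n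
      using d by simp
    ultimately have *: "d * (a * (real n * ((1 - 1 / d) / d))) = h * real n - h / d\<^sup>2 * real n" for n
      by (simp only: left_diff_distrib)
    have "h / d\<^sup>2 * real n \<le> d * (ln d + a + C) + d * ln (2 * real (Suc n))" for n
    proof -
      have "d * (ln d + (ln (2 * real (Suc n)) + a * (real n * ((1 - 1 / d) / d)) + a + C))
          = d * (ln d + a + C) + d * ln (2 * real (Suc n)) + d * (a * (real n * ((1 - 1 / d) / d)))"
        by (simp only: distrib_left add_ac)
      then show ?thesis using le[of n] unfolding * by linarith
    qed
    moreover have "0 < h / d\<^sup>2" using \<open>0 < h\<close> d by simp
    ultimately show False using linear_not_le_log[of "h / d\<^sup>2" "d * (ln d + a + C)" d]
      by (meson not_less)
  qed
  then show ?thesis using ub[OF assms] by auto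
qed

section \<open>Almost invariance under the generators\<close>

lemma measure_walk_act_A:
  fixes x0 :: "'x :: finite"
  assumes "a \<in> carrier mother_A"
  shows "measure (walk x0 n) ((\<lambda>h. h \<circ> act_A a) -` S) = measure (walk x0 n) S"
proof -
  \<comment> \<open>Invariance under \<open>A\<close> is exact: the first factor
    \<open>walk_A\<close> absorbs \<open>act_A a\<close>.\<close>
  have "return_pmf (act_A a) \<star> walk x0 n = return_pmf (act_A a) \<star> walk_A \<star> walk x0 n"
    by (simp add: conv_assoc walk_idem)
  also have "return_pmf (act_A a) \<star> walk_A = walk_A"
    using assms by (intro walk_A_conv) auto
  finally have "map_pmf (\<lambda>h. h \<circ> act_A a) (walk x0 n) = walk x0 n"
    by (simp add: walk_idem) (simp add: conv_pmf_def bind_return_pmf)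
  then show ?thesis by (metis measure_map_pmf)
qed

lemma id_in_set_walk_B: "id \<in> set_pmf (walk_B (x0 :: 'x :: finite))"
proof -
  have "act_B x0 \<one>\<^bsub>mother_B x0\<^esub> = id" by (rule ext) (simp add: act_B_one)
  moreover have "\<one>\<^bsub>mother_B x0\<^esub> \<in> carrier (mother_B x0)"
    by (intro monoid.one_closed group.is_monoid group_mother_B)
  ultimately show ?thesis by (metis imageI set_walk_B)
qed

text \<open>The translates by \<open>g\<close> and by \<open>id\<close> are both compared with the
  average \<open>?B \<star> ?W\<close>. The weighted squared deviations sum to at most the entropy
  increment up to the factor 4, so each single one is at most 4 times the increment divided by its
  weight; the inequality \<open>(u - v)\<^sup>2 \<le> 2 * u\<^sup>2 + 2 * v\<^sup>2\<close> turns 4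
  into 8.\<close>

lemma measure_walk_act_B:
  fixes x0 :: "'x :: finite"
  assumes g: "g \<in> set_pmf (walk_B x0)"
  shows "(measure (walk x0 n) ((\<lambda>h. h \<circ> g) -` S) - measure (walk x0 n) S)\<^sup>2
    \<le> 8 * (1 / pmf (walk_B x0) g + 1 / pmf (walk_B x0) id) * (walk_entropy x0 (Suc n) - walk_entropy x0 n)"
proof -
  let ?B = "walk_B x0" and ?W = "walk x0 n"
  let ?D = "\<lambda>g. measure ?W ((\<lambda>h. h \<circ> g) -` S) - measure (?B \<star> ?W) S"
  define \<delta> where "\<delta> = walk_entropy x0 (Suc n) - walk_entropy x0 n"
  have "shannon (?B \<star> ?W) \<le> walk_entropy x0 (Suc n)"
    unfolding walk_entropy_def walk_Suc_left
    by (intro shannon_conv_ge_right finite_set_conv finite_walk finite_walk_A finite_walk_B)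
      (erule surj_mother[OF set_walk_A_mother])
  moreover have "shannon ?W + (\<Sum>g\<in>set_pmf ?B. pmf ?B g * (?D g)\<^sup>2 / 4) \<le> shannon (?B \<star> ?W)"
    by (intro shannon_conv_ge finite_walk finite_walk_B) (erule surj_mother[OF set_walk_B_mother])
  ultimately have sum: "(\<Sum>g\<in>set_pmf ?B. pmf ?B g * (?D g)\<^sup>2 / 4) \<le> \<delta>"
    by (simp add: \<delta>_def walk_entropy_def)
  have D: "(?D g)\<^sup>2 \<le> 4 * (1 / pmf ?B g) * \<delta>" if "g \<in> set_pmf ?B" for g
  proof -
    have "pmf ?B g * (?D g)\<^sup>2 / 4 \<le> (\<Sum>g\<in>set_pmf ?B. pmf ?B g * (?D g)\<^sup>2 / 4)"
      by (rule member_le_sum[OF that]) (auto simp: finite_walk_B)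
    then have "pmf ?B g * (?D g)\<^sup>2 \<le> 4 * \<delta>" using sum by linarith
    then show ?thesis using pmf_positive[OF that] by (simp add: field_simps)
  qed
  have "(\<lambda>h. h \<circ> id) -` S = S" by auto
  then have "(measure ?W ((\<lambda>h. h \<circ> g) -` S) - measure ?W S)\<^sup>2 = (?D g - ?D id)\<^sup>2" by simp
  also have "\<dots> \<le> 2 * (?D g)\<^sup>2 + 2 * (?D id)\<^sup>2"
  proof -
    have "(u - v)\<^sup>2 + (u + v)\<^sup>2 = 2 * u\<^sup>2 + 2 * v\<^sup>2" for u v :: real
      by (simp add: power2_eq_square algebra_simps)
    then show ?thesis by (smt (verit) zero_le_power2)
  qed
  also have "\<dots> \<le> 2 * (4 * (1 / pmf ?B g) * \<delta>) + 2 * (4 * (1 / pmf ?B id) * \<delta>)"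
    by (intro add_mono mult_left_mono D g id_in_set_walk_B) auto
  also have "\<dots> = 8 * (1 / pmf ?B g + 1 / pmf ?B id) * \<delta>" by (simp add: algebra_simps)
  finally show ?thesis unfolding \<delta>_def .
qed

text \<open>One sequence \<open>N\<close> serves all \<open>g\<close> and \<open>S\<close>: for
  generators in \<open>B\<close> the squared defect is at most a constant depending on
  \<open>g\<close> times the increment, and \<open>N k\<close> is chosen with increment below
  \<open>1 / real (Suc k)\<close>.\<close>

lemma almost_invariant_walks:
  fixes x0 :: "'x :: finite"
  shows "\<exists>N. \<forall>g\<in>carrier (mother_group x0). \<forall>S.
    (\<lambda>k. measure (walk x0 (N k)) ((\<lambda>h. h \<circ> g) -` S) - measure (walk x0 (N k)) S) \<longlonglongrightarrow> 0"
proof -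
  have "\<exists>n. walk_entropy x0 (Suc n) - walk_entropy x0 n < 1 / real (Suc k)" for k
    by (intro small_increment walk_entropy_nonneg walk_entropy_sublinear) auto
  then obtain N where N: "\<And>k. walk_entropy x0 (Suc (N k)) - walk_entropy x0 (N k) < 1 / real (Suc k)"
    by metis
  let ?D = "\<lambda>g S k. measure (walk x0 (N k)) ((\<lambda>h. h \<circ> g) -` S) - measure (walk x0 (N k)) S"
  have gens: "?D g S \<longlonglongrightarrow> 0" if "g \<in> mother_gens x0" for g S
    using that
  proof
    assume "g \<in> act_A ` carrier mother_A"
    then show ?thesis by (auto simp: measure_walk_act_A)
  next
    assume "g \<in> act_B x0 ` carrier (mother_B x0)"
    then have g: "g \<in> set_pmf (walk_B x0)" by (simp add: set_walk_B)
    define c where "c = 8 * (1 / pmf (walk_B x0) g + 1 / pmf (walk_B x0) id)"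
    have "0 \<le> c" by (simp add: c_def)
    have bound: "norm ((?D g S k)\<^sup>2) \<le> c * (1 / real (Suc k))" for k
      using measure_walk_act_B[OF g, of "N k" S] mult_left_mono[OF less_imp_le[OF N[of k]] \<open>0 \<le> c\<close>]
      unfolding c_def[symmetric] real_norm_def abs_power2 by (rule order_trans)
    have "(\<lambda>k. c * (1 / real (Suc k))) \<longlonglongrightarrow> 0"
      using tendsto_mult_right_zero[OF LIMSEQ_inverse_real_of_nat, of c] by (simp add: inverse_eq_divide)
    with always_eventually[OF allI[OF bound]] have "(\<lambda>k. (?D g S k)\<^sup>2) \<longlonglongrightarrow> 0"
      by (rule Lim_null_comparison)
    then have "(\<lambda>k. sqrt ((?D g S k)\<^sup>2)) \<longlonglongrightarrow> sqrt 0" by (rule tendsto_real_sqrt)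
    then show ?thesis unfolding real_sqrt_abs real_sqrt_zero by (rule tendsto_rabs_zero_cancel)
  qed
  have gens_inv: "?D (inv\<^bsub>tree_aut\<^esub> g) S \<longlonglongrightarrow> 0" if "g \<in> mother_gens x0" for g S
  proof -
    interpret W: group tree_aut by (rule group_tree_aut)
    have "g \<in> carrier tree_aut" using that by (auto intro: act_A_in_tree_aut act_B_in_tree_aut)
    then have "inv\<^bsub>tree_aut\<^esub> g \<otimes>\<^bsub>tree_aut\<^esub> g = \<one>\<^bsub>tree_aut\<^esub>" by simp
    then have "g \<circ> inv\<^bsub>tree_aut\<^esub> g = id" by (simp add: tree_aut_def)
    \<comment> \<open>The statement for \<open>g\<close>, tested on the preimage of \<open>S\<close>
      under the inverse translation, is the statement for the inverse up to sign.\<close>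
    then have "(\<lambda>h. h \<circ> g) -` (\<lambda>h. h \<circ> inv\<^bsub>tree_aut\<^esub> g) -` S = S"
      by (simp add: vimage_def comp_assoc)
    then show ?thesis
      using tendsto_minus[OF gens[OF that, of "(\<lambda>h. h \<circ> inv\<^bsub>tree_aut\<^esub> g) -` S"]] by simp
  qed
  have "?D g S \<longlonglongrightarrow> 0" if "g \<in> generate tree_aut (mother_gens x0)" for g S
    using that
  proof (induction arbitrary: S rule: generate.induct)
    case one
    have "(\<lambda>h. h \<circ> id) -` S = S" by auto
    then show ?case by (simp add: tree_aut_def)
  next
    case (incl h)
    then show ?case by (rule gens)
  next
    case (inv h)
    then show ?case by (rule gens_inv)
  next
    case (eng h1 h2)
    have preimage: "(\<lambda>h. h \<circ> (h1 \<otimes>\<^bsub>tree_aut\<^esub> h2)) -` S = (\<lambda>h. h \<circ> h2) -` (\<lambda>h. h \<circ> h1) -` S"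
      by (auto simp: tree_aut_def comp_assoc)
    \<comment> \<open>The defect of a product telescopes. This needs the induction hypothesis for
      arbitrary sets, here for a preimage of \<open>S\<close>.\<close>
    have "?D (h1 \<otimes>\<^bsub>tree_aut\<^esub> h2) S k = ?D h2 ((\<lambda>h. h \<circ> h1) -` S) k + ?D h1 S k" for k
      unfolding preimage by linarith
    then show ?case
      using tendsto_add[OF eng.IH(2)[of "(\<lambda>h. h \<circ> h1) -` S"] eng.IH(1)[of S]]
      by (simp only: add_0_left)
  qed
  then show ?thesis unfolding carrier_mother_group by (intro exI[of _ N] ballI allI)
qed

theorem theorem3p6:
  fixes x0 :: "'x :: finite"
  shows "amenable (mother_group x0)"
proof -
  let ?G = "mother_group x0"
  obtain N where "\<forall>g\<in>carrier ?G. \<forall>S.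
    (\<lambda>k. measure (walk x0 (N k)) ((\<lambda>h. h \<circ> g) -` S) - measure (walk x0 (N k)) S) \<longlonglongrightarrow> 0"
    using almost_invariant_walks ..
  note N = bspec[OF this, THEN spec]
  \<comment> \<open>The coordinates range over all sets of maps on words; the walks are supported in
    the Mother group, so its carrier has mass 1 for every \<open>k\<close>.\<close>
  define Q where "Q = (\<lambda>k S. measure (measure_pmf (walk x0 (N k))) S)"
  have "\<exists>\<mu>. (\<forall>S. 0 \<le> \<mu> S) \<and>
      (\<forall>\<phi> c. continuous_on UNIV \<phi> \<longrightarrow> (\<lambda>k. \<phi> (Q k)) \<longlonglongrightarrow> c \<longrightarrow> \<phi> \<mu> = (c :: real))"
    by (rule bounded_cluster_function) (simp add: Q_def)
  then obtain \<mu> where \<mu>: "\<forall>S. 0 \<le> \<mu> S"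
    "\<forall>\<phi> c. continuous_on UNIV \<phi> \<longrightarrow> (\<lambda>k. \<phi> (Q k)) \<longlonglongrightarrow> c \<longrightarrow> \<phi> \<mu> = (c :: real)"
    by (elim exE conjE)
  note nonneg = \<mu>(1)[rule_format] and lim = \<mu>(2)[rule_format]
  have one: "\<mu> (carrier ?G) = 1"
  proof (rule lim)
    have "Q k (carrier ?G) = 1" for k
      using set_walk_mother[of x0 "N k"] unfolding Q_def
      by (subst measure_pmf.prob_eq_1) (auto simp: AE_measure_pmf_iff)
    then show "(\<lambda>k. Q k (carrier ?G)) \<longlonglongrightarrow> 1" by simp
  qed (rule continuous_on_product_coordinates)
  have add: "\<mu> (S \<union> T) = \<mu> S + \<mu> T" if "S \<inter> T = {}" for S T
  proof -
    \<comment> \<open>Additivity, like invariance below, says that a continuous function of finitely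
      many coordinates vanishes, so it passes to the cluster point.\<close>
    have "\<mu> (S \<union> T) - \<mu> S - \<mu> T = 0"
    proof (rule lim[where \<phi> = "\<lambda>\<mu>. \<mu> (S \<union> T) - \<mu> S - \<mu> T"])
      have "Q k (S \<union> T) = Q k S + Q k T" for k
        unfolding Q_def by (rule measure_pmf.finite_measure_Union) (use that in auto)
      then show "(\<lambda>k. Q k (S \<union> T) - Q k S - Q k T) \<longlonglongrightarrow> 0" by simp
    qed (intro continuous_intros continuous_on_product_coordinates)
    then show ?thesis by simp
  qed
  have inv: "\<mu> (g <#\<^bsub>?G\<^esub> S) = \<mu> S" if g: "g \<in> carrier ?G" for g S
  proof -
    have coset: "g <#\<^bsub>?G\<^esub> S = (\<lambda>h. h \<circ> g) ` S"
      by (auto simp: l_coset_def mother_group_mult)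
    have "inj (\<lambda>h. h \<circ> g)"
    proof (rule injI)
      fix h k assume "h \<circ> g = k \<circ> g"
      then show "h = k"
        using bij_is_surj[OF mother_group_bij[OF g]] by (metis surj_fun_eq UNIV_I fun_eq_iff comp_apply surjD)
    qed
    \<comment> \<open>Almost invariance is stated for preimages. Tested on the coset, whose preimage
      is \<open>S\<close>, it compares \<open>S\<close> with its translate.\<close>
    then have pre: "(\<lambda>h. h \<circ> g) -` (g <#\<^bsub>?G\<^esub> S) = S"
      unfolding coset by (rule inj_vimage_image_eq)
    have "\<mu> S - \<mu> (g <#\<^bsub>?G\<^esub> S) = 0"
    proof (rule lim[where \<phi> = "\<lambda>\<mu>. \<mu> S - \<mu> (g <#\<^bsub>?G\<^esub> S)"])
      show "(\<lambda>k. Q k S - Q k (g <#\<^bsub>?G\<^esub> S)) \<longlonglongrightarrow> 0"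
        using N[OF g, of "g <#\<^bsub>?G\<^esub> S"] unfolding pre Q_def .
    qed (intro continuous_intros continuous_on_product_coordinates)
    then show ?thesis by simp
  qed
  show ?thesis
    unfolding amenable_def
    by (intro conjI exI[of _ \<mu>] allI impI ballI group_mother_group nonneg one add inv)
qed

end
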